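(* Let $k$ be a field, let $n,m\ge1$, and let $\{p_{ij}\}_{1\le i,j\le n}$ and $\{p'_{ij}\}_{1\le i,j\le m}$ be families of nonzero scalars with $p_{ii}=1$, $p_{ji}=p_{ij}^{-1}$ (and likewise for $p'$), and suppose $p_{ij}\neq1$ for all $i\neq j$ (for the family $p$). Let $A=k_{p_{ij}}[x_1,\dots,x_n]/M$ where $M$ is a graded ideal of $k_{p_{ij}}[x_1,\dots,x_n]$ contained in $k_{p_{ij}}[x_1,\dots,x_n]_{\ge3}$, and let $B=k_{p'_{ij}}[x_1,\dots,x_m]/N$ where $N$ is a graded ideal of $k_{p'_{ij}}[x_1,\dots,x_m]$ contained in $k_{p'_{ij}}[x_1,\dots,x_m]_{\ge2}$. If $A\cong B$ as ungraded algebras, then $n=m$, there is a permutation $\sigma\in S_n$ with $p'_{ij}=p_{\sigma(i)\sigma(j)}$ for all $i,j$, and there are scalars $c_1,\dots,c_n\in k^\times$ such that $x_i\mapsto c_i x_{\sigma(i)}$ defines a graded algebra isomorphism $B\to A$ (i.e. after an elementary change of generators of $A$, $A=B$).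
   Context: The skew polynomial ring $k_{p_{ij}}[x_1,\dots,x_n]$ is the $k$-algebra generated by $x_1,\dots,x_n$ subject to the relations $x_jx_i=p_{ij}x_ix_j$ for all $i,j$; it is graded with each $x_i$ of degree $1$, and $R_{\ge d}$ denotes the span of homogeneous elements of degree $\ge d$. An elementary change of generators replaces the ordered set $\{x_1,\dots,x_n\}$ by $\{a_1x_{\sigma(1)},\dots,a_nx_{\sigma(n)}\}$ with $a_i\in k^\times$ and $\sigma\in S_n$. *)

theory Defs
  imports "HOL-Algebra.QuotRing"
begin

text \<open>Skew polynomial ring k_p[x_0,...,x_{n-1}] (0-based indices), with the relations
  x_j x_i = p i j * x_i x_j.  Elements are represented in the PBW basis of ordered
  monomials x^a = x_0^{a_0} ... x_{n-1}^{a_{n-1}}, i.e. as finitely supported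
  coefficient functions on exponent vectors a :: nat => nat vanishing outside {0..<n}.\<close>

type_synonym 'k skpoly = "(nat \<Rightarrow> nat) \<Rightarrow> 'k"

definition sk_carrier :: "nat \<Rightarrow> ('k::field) skpoly set" where
  "sk_carrier n = {f. finite {a. f a \<noteq> 0} \<and> (\<forall>a. f a \<noteq> 0 \<longrightarrow> (\<forall>i\<ge>n. a i = 0))}"

text \<open>Twist factor: x^b x^c = sk_twist p n b c * x^(b+c), since x_i x_j = p j i * x_j x_i.\<close>
definition sk_twist :: "(nat \<Rightarrow> nat \<Rightarrow> 'k::field) \<Rightarrow> nat \<Rightarrow> (nat \<Rightarrow> nat) \<Rightarrow> (nat \<Rightarrow> nat) \<Rightarrow> 'k" where
  "sk_twist p n b c = (\<Prod>i<n. \<Prod>j<i. p j i ^ (b i * c j))"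

definition sk_mult :: "(nat \<Rightarrow> nat \<Rightarrow> 'k::field) \<Rightarrow> nat \<Rightarrow> 'k skpoly \<Rightarrow> 'k skpoly \<Rightarrow> 'k skpoly" where
  "sk_mult p n f g = (\<lambda>a. \<Sum>(b, c) \<in> {(b, c). f b \<noteq> 0 \<and> g c \<noteq> 0 \<and> (\<lambda>i. b i + c i) = a}.
      sk_twist p n b c * f b * g c)"

definition sk_const :: "'k::field \<Rightarrow> 'k skpoly" where
  "sk_const c = (\<lambda>a. if a = (\<lambda>_. 0) then c else 0)"

definition skew_ring :: "(nat \<Rightarrow> nat \<Rightarrow> 'k::field) \<Rightarrow> nat \<Rightarrow> 'k skpoly ring" where
  "skew_ring p n = \<lparr>carrier = sk_carrier n, mult = sk_mult p n, one = sk_const 1,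
      zero = (\<lambda>_. 0), add = (\<lambda>f g a. f a + g a)\<rparr>"

definition sk_var :: "nat \<Rightarrow> ('k::field) skpoly" where
  "sk_var i = (\<lambda>a. if a = (\<lambda>j. if j = i then 1 else 0) then 1 else 0)"

definition mdeg :: "nat \<Rightarrow> (nat \<Rightarrow> nat) \<Rightarrow> nat" where
  "mdeg n a = (\<Sum>i<n. a i)"

definition hom_comp :: "nat \<Rightarrow> nat \<Rightarrow> ('k::field) skpoly \<Rightarrow> 'k skpoly" where
  "hom_comp n d f = (\<lambda>a. if mdeg n a = d then f a else 0)"

definition graded_ideal :: "(nat \<Rightarrow> nat \<Rightarrow> 'k::field) \<Rightarrow> nat \<Rightarrow> 'k skpoly set \<Rightarrow> bool" where
  "graded_ideal p n I \<longleftrightarrow> ideal I (skew_ring p n) \<and> (\<forall>f\<in>I. \<forall>d. hom_comp n d f \<in> I)"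

definition in_deg_ge :: "nat \<Rightarrow> nat \<Rightarrow> ('k::field) skpoly set \<Rightarrow> bool" where
  "in_deg_ge n d I \<longleftrightarrow> (\<forall>f\<in>I. \<forall>a. f a \<noteq> 0 \<longrightarrow> d \<le> mdeg n a)"

definition skew_params :: "nat \<Rightarrow> (nat \<Rightarrow> nat \<Rightarrow> 'k::field) \<Rightarrow> bool" where
  "skew_params n p \<longleftrightarrow> (\<forall>i<n. \<forall>j<n. p i j \<noteq> 0 \<and> p j i = inverse (p i j)) \<and> (\<forall>i<n. p i i = 1)"

text \<open>k-algebra isomorphism between quotient rings R/M and R'/N: a ring isomorphism
  which is the identity on scalars (this is equivalent to k-linearity).\<close>
definition alg_iso_quot ::
  "(nat \<Rightarrow> nat \<Rightarrow> 'k::field) \<Rightarrow> nat \<Rightarrow> 'k skpoly set \<Rightarrow>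
   (nat \<Rightarrow> nat \<Rightarrow> 'k) \<Rightarrow> nat \<Rightarrow> 'k skpoly set \<Rightarrow> ('k skpoly set \<Rightarrow> 'k skpoly set) \<Rightarrow> bool" where
  "alg_iso_quot p n M p' m N \<phi> \<longleftrightarrow>
     \<phi> \<in> ring_iso (skew_ring p n Quot M) (skew_ring p' m Quot N) \<and>
     (\<forall>c. \<phi> (M +>\<^bsub>skew_ring p n\<^esub> sk_const c) = N +>\<^bsub>skew_ring p' m\<^esub> sk_const c)"

primrec sk_pow :: "(nat \<Rightarrow> nat \<Rightarrow> 'k::field) \<Rightarrow> nat \<Rightarrow> 'k skpoly \<Rightarrow> nat \<Rightarrow> 'k skpoly" where
  "sk_pow p n h 0 = sk_const 1"
| "sk_pow p n h (Suc k) = sk_mult p n (sk_pow p n h k) h"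

definition sk_mono_image :: "(nat \<Rightarrow> nat \<Rightarrow> 'k::field) \<Rightarrow> nat \<Rightarrow> nat \<Rightarrow> (nat \<Rightarrow> 'k skpoly) \<Rightarrow> (nat \<Rightarrow> nat) \<Rightarrow> 'k skpoly" where
  "sk_mono_image p n m g a = foldl (\<lambda>acc i. sk_mult p n acc (sk_pow p n (g i) (a i))) (sk_const 1) [0..<m]"

definition sk_subst :: "(nat \<Rightarrow> nat \<Rightarrow> 'k::field) \<Rightarrow> nat \<Rightarrow> nat \<Rightarrow> (nat \<Rightarrow> 'k skpoly) \<Rightarrow> 'k skpoly \<Rightarrow> 'k skpoly" where
  "sk_subst p n m g f = (\<lambda>b. \<Sum>a\<in>{a. f a \<noteq> 0}. f a * sk_mono_image p n m g a b)"

end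

theory Submission
  imports Defs "HOL-Library.Function_Algebras" "HOL-Combinatorics.Permutations"
begin

text \<open>An isomorphism A = B sends each x_i to some g_i in B; let a_i be the constant term of g_i.

  If all a_i vanish, the isomorphism matches the augmentation ideals, hence their powers, and the
  linear parts of the images of the generators form mutually inverse matrices, so n = m. Let K be
  the matrix of the linear parts of the images of the generators of B. As M starts in degree 3, the
  quadratic parts of the relations of B hold exactly in the skew polynomial ring over A. Comparing
  coefficients, p'_ij = 1 for some i, j distinct would make two rows of K proportional; so p'_ij is
  never 1, and the squares x_s^2 force K_is K_js = 0. Thus K is a monomial matrix, which gives the
  permutation and the scalars, and comparing lowest-degree terms shows that the resulting graded map
  carries N onto M.

  If a_s is nonzero, then x_s x_j = p_js x_j x_s with p_js distinct from 1 makes the images of all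
  other generators start in degree 2. So the cotangent space of B at the origin is spanned by the
  linear part of g_s and m = 1; by symmetry n = 1. The character of A given by the constant term
  in B is nonzero on x_0, hence on every monomial, so the graded ideal M is zero; by symmetry so is N.\<close>

section \<open>Arithmetic of skew polynomials\<close>

definition exps :: "nat \<Rightarrow> (nat \<Rightarrow> nat) set" where
  "exps n = {a. \<forall>i\<ge>n. a i = 0}"

definition unit_exp :: "nat \<Rightarrow> nat \<Rightarrow> nat" where
  "unit_exp i = (\<lambda>j. if j = i then 1 else 0)"

definition sk_mono :: "(nat \<Rightarrow> nat) \<Rightarrow> 'k::field \<Rightarrow> 'k skpoly" where
  "sk_mono a u = (\<lambda>b. if b = a then u else 0)"

text \<open>This is the d-th power of the augmentation ideal (compare
  \<open>sk_ge_Suc_induct\<close>), so an isomorphism matching the augmentation ideals respects it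
  even if it ignores the grading.\<close>

definition sk_ge :: "nat \<Rightarrow> nat \<Rightarrow> ('k::field) skpoly set" where
  "sk_ge n d = {f \<in> sk_carrier n. \<forall>a. f a \<noteq> 0 \<longrightarrow> d \<le> mdeg n a}"

lemma sk_carrier_iff: "f \<in> sk_carrier n \<longleftrightarrow> finite {a. f a \<noteq> 0} \<and> {a. f a \<noteq> 0} \<subseteq> exps n"
  by (auto simp: sk_carrier_def exps_def)

lemma sk_carrier_eq_0: "f \<in> sk_carrier n \<Longrightarrow> a \<notin> exps n \<Longrightarrow> f a = 0"
  by (auto simp: sk_carrier_iff)

lemma exps_add: "a \<in> exps n \<Longrightarrow> b \<in> exps n \<Longrightarrow> a + b \<in> exps n"
  by (auto simp: exps_def)

lemma exps_le: "a \<in> exps n \<Longrightarrow> b \<le> a \<Longrightarrow> b \<in> exps n"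
  by (auto simp: exps_def le_fun_def) (metis le_zero_eq)

lemma exps_minus: "a \<in> exps n \<Longrightarrow> a - b \<in> exps n"
  by (auto simp: exps_def)

lemma zero_exps [simp]: "0 \<in> exps n"
  by (auto simp: exps_def)

lemma unit_exp_exps [simp]: "unit_exp i \<in> exps n \<longleftrightarrow> i < n"
  by (auto simp: exps_def unit_exp_def)

lemma unit_exp_self [simp]: "unit_exp i i = 1"
  by (simp add: unit_exp_def)

lemma unit_exp_eq_iff [simp]: "unit_exp i = unit_exp j \<longleftrightarrow> i = j"
  by (auto simp: unit_exp_def fun_eq_iff)

lemma unit_exp_neq_0 [simp]: "unit_exp i \<noteq> 0" "0 \<noteq> unit_exp i"
  by (auto simp: unit_exp_def fun_eq_iff)

lemma mdeg_add: "mdeg n (a + b) = mdeg n a + mdeg n b"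
  by (simp add: mdeg_def sum.distrib)

lemma mdeg_0 [simp]: "mdeg n 0 = 0"
  by (simp add: mdeg_def)

lemma mdeg_unit_exp [simp]: "i < n \<Longrightarrow> mdeg n (unit_exp i) = 1"
  by (simp add: mdeg_def unit_exp_def)

lemma mdeg_pos: "0 < mdeg n a \<Longrightarrow> \<exists>i<n. 0 < a i"
  unfolding mdeg_def by (rule ccontr) simp

lemma mdeg_eq_0: "a \<in> exps n \<Longrightarrow> mdeg n a = 0 \<longleftrightarrow> a = 0"
  by (auto simp: mdeg_def exps_def fun_eq_iff) (metis lessThan_iff not_le)

lemma add_diff_exp: "b \<le> (a :: nat \<Rightarrow> nat) \<Longrightarrow> b + (a - b) = a"
  by (auto simp: le_fun_def fun_eq_iff)

lemma mdeg_diff: "b \<le> a \<Longrightarrow> mdeg n a = mdeg n b + mdeg n (a - b)"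
  by (metis add_diff_exp mdeg_add)

lemma unit_exp_le_iff: "unit_exp i \<le> a \<longleftrightarrow> 0 < a i"
  by (auto simp: le_fun_def unit_exp_def Suc_le_eq)

lemma finite_exps_le:
  assumes a: "a \<in> exps n"
  shows "finite {b. b \<le> a}"
proof -
  \<comment> \<open>The sum of all entries of \<open>a\<close> is a single bound that serves every
    coordinate.\<close>
  let ?F = "{f. \<forall>x. (x \<in> {..<n} \<longrightarrow> f x \<in> {..(\<Sum>i<n. a i)}) \<and> (x \<notin> {..<n} \<longrightarrow> f x = 0)}"
  have "finite ?F"
    by (rule finite_set_of_finite_funs) simp_all
  moreover have "b \<in> ?F" if b: "b \<le> a" for b
  proof -
    have "b x \<le> (\<Sum>i<n. a i)" if "x < n" for x
      using le_funD[OF b, of x] member_le_sum[of x "{..<n}" a] that by simp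
    moreover have "b x = 0" if "\<not> x < n" for x
      using exps_le[OF a b] that by (simp add: exps_def)
    ultimately show ?thesis by simp
  qed
  then have "{b. b \<le> a} \<subseteq> ?F" by blast
  ultimately show ?thesis by (rule rev_finite_subset)
qed

section \<open>Multiplication and its coefficients in low degree\<close>

text \<open>Substituting c = a - b turns the index set into the exponents below \<open>a\<close>,
  which does not depend on the two factors. Bilinearity and the formulas for low-degree coefficients
  then follow termwise.\<close>

lemma sk_mult_eval:
  assumes f: "f \<in> sk_carrier n" and a: "a \<in> exps n"
  shows "sk_mult p n f g a = (\<Sum>b | b \<le> a. sk_twist p n b (a - b) * f b * g (a - b))"
proof -
  let ?S = "{(b, c). f b \<noteq> 0 \<and> g c \<noteq> 0 \<and> (\<lambda>i. b i + c i) = a}"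
  let ?B = "{b. b \<le> a \<and> f b \<noteq> 0 \<and> g (a - b) \<noteq> 0}"
  have fin: "finite {b. b \<le> a}" by (rule finite_exps_le[OF a])
  have bij: "bij_betw (\<lambda>b. (b, a - b)) ?B ?S"
    by (rule bij_betw_byWitness[where f' = fst])
      (auto simp: le_fun_def fun_diff_def)
  have "sk_mult p n f g a = (\<Sum>b\<in>?B. sk_twist p n b (a - b) * f b * g (a - b))"
    unfolding sk_mult_def using sum.reindex_bij_betw[OF bij, of "\<lambda>(b, c). sk_twist p n b c * f b * g c"]
    by (simp add: fun_diff_def)
  also have "\<dots> = (\<Sum>b | b \<le> a. sk_twist p n b (a - b) * f b * g (a - b))"
    by (rule sum.mono_neutral_left) (use fin in auto)
  finally show ?thesis .
qed

lemma sk_mult_outside: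
  assumes "f \<in> sk_carrier n" "g \<in> sk_carrier n" "a \<notin> exps n"
  shows "sk_mult p n f g a = 0"
proof -
  have "{(b, c). f b \<noteq> 0 \<and> g c \<noteq> 0 \<and> (\<lambda>i. b i + c i) = a} = {}"
    using assms exps_add by (fastforce simp: sk_carrier_iff plus_fun_def)
  then show ?thesis by (simp only: sk_mult_def sum.empty)
qed

lemma sk_mult_nonzeroD:
  assumes "sk_mult p n f g a \<noteq> 0"
  obtains b c where "f b \<noteq> 0" "g c \<noteq> 0" "a = b + c"
proof -
  have "{(b, c). f b \<noteq> 0 \<and> g c \<noteq> 0 \<and> (\<lambda>i. b i + c i) = a} \<noteq> {}"
    using assms unfolding sk_mult_def by (metis (no_types, lifting) sum.empty)
  then obtain b c where "f b \<noteq> 0" "g c \<noteq> 0" "(\<lambda>i. b i + c i) = a" by blast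
  then show ?thesis using that[of b c] by (auto simp: plus_fun_def)
qed

lemma sk_mult_closed:
  assumes "f \<in> sk_carrier n" "g \<in> sk_carrier n"
  shows "sk_mult p n f g \<in> sk_carrier n"
proof -
  have "{a. sk_mult p n f g a \<noteq> 0} \<subseteq> (\<lambda>(b, c). b + c) ` ({b. f b \<noteq> 0} \<times> {c. g c \<noteq> 0})"
  proof
    fix a assume "a \<in> {a. sk_mult p n f g a \<noteq> 0}"
    then obtain b c where "f b \<noteq> 0" "g c \<noteq> 0" "a = b + c"
      by (blast elim: sk_mult_nonzeroD)
    then show "a \<in> (\<lambda>(b, c). b + c) ` ({b. f b \<noteq> 0} \<times> {c. g c \<noteq> 0})"
      by (intro image_eqI[where x = "(b, c)"]) simp_all
  qed
  moreover have "finite ({b. f b \<noteq> 0} \<times> {c. g c \<noteq> 0})"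
    using assms by (auto simp: sk_carrier_iff)
  ultimately have "finite {a. sk_mult p n f g a \<noteq> 0}"
    by (rule finite_subset[OF _ finite_imageI])
  moreover have "{a. sk_mult p n f g a \<noteq> 0} \<subseteq> exps n"
    using sk_mult_outside[OF assms] by auto
  ultimately show ?thesis by (simp add: sk_carrier_iff)
qed

lemma sk_carrier_0 [simp]: "0 \<in> sk_carrier n"
  by (simp add: sk_carrier_iff)

lemma sk_carrier_add:
  assumes "f \<in> sk_carrier n" "g \<in> sk_carrier n"
  shows "f + g \<in> sk_carrier n"
proof -
  have "{a. (f + g) a \<noteq> 0} \<subseteq> {a. f a \<noteq> 0} \<union> {a. g a \<noteq> 0}" by auto
  then show ?thesis using assms unfolding sk_carrier_iff
    by (meson finite_UnI finite_subset le_sup_iff order_trans)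
qed

lemma sk_carrier_uminus: "f \<in> sk_carrier n \<Longrightarrow> - f \<in> sk_carrier n"
  by (simp add: sk_carrier_iff)

lemma sk_carrier_diff: "f \<in> sk_carrier n \<Longrightarrow> g \<in> sk_carrier n \<Longrightarrow> f - g \<in> sk_carrier n"
  using sk_carrier_add[of f n "- g"] sk_carrier_uminus[of g n] by simp

lemma sk_mono_closed: "a \<in> exps n \<Longrightarrow> sk_mono a u \<in> sk_carrier n"
proof -
  assume "a \<in> exps n"
  moreover have "{b. sk_mono a u b \<noteq> 0} \<subseteq> {a}" by (auto simp: sk_mono_def)
  ultimately show ?thesis unfolding sk_carrier_iff
    using finite_subset by fastforce
qed

lemma sk_const_mono: "sk_const c = sk_mono 0 c"
  by (simp add: sk_const_def sk_mono_def zero_fun_def)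

lemma sk_var_mono: "sk_var i = sk_mono (unit_exp i) 1"
  by (simp add: sk_var_def sk_mono_def unit_exp_def)

lemma sk_const_0: "sk_const 0 = 0"
  by (simp add: sk_const_def zero_fun_def)

lemma sk_const_closed [simp]: "sk_const c \<in> sk_carrier n"
  by (simp add: sk_const_mono sk_mono_closed)

lemma sk_var_closed [simp]: "i < n \<Longrightarrow> sk_var i \<in> sk_carrier n"
  by (simp add: sk_var_mono sk_mono_closed)

lemma sk_mult_add_left:
  assumes "f \<in> sk_carrier n" "g \<in> sk_carrier n" "h \<in> sk_carrier n"
  shows "sk_mult p n (f + g) h = sk_mult p n f h + sk_mult p n g h"
proof
  fix a show "sk_mult p n (f + g) h a = (sk_mult p n f h + sk_mult p n g h) a"
    using assms
    by (cases "a \<in> exps n") (simp_all add: sk_mult_eval sk_mult_outside sk_carrier_add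
        sum.distrib[symmetric] algebra_simps)
qed

lemma sk_mult_add_right:
  assumes "f \<in> sk_carrier n" "g \<in> sk_carrier n" "h \<in> sk_carrier n"
  shows "sk_mult p n f (g + h) = sk_mult p n f g + sk_mult p n f h"
proof
  fix a show "sk_mult p n f (g + h) a = (sk_mult p n f g + sk_mult p n f h) a"
    using assms
    by (cases "a \<in> exps n") (simp_all add: sk_mult_eval sk_mult_outside sk_carrier_add
        sum.distrib[symmetric] algebra_simps)
qed

lemma sk_mult_uminus_left:
  assumes "f \<in> sk_carrier n" "g \<in> sk_carrier n"
  shows "sk_mult p n (- f) g = - sk_mult p n f g"
proof
  fix a show "sk_mult p n (- f) g a = (- sk_mult p n f g) a"
    using assms
    by (cases "a \<in> exps n") (simp_all add: sk_mult_eval sk_mult_outside sk_carrier_uminus sum_negf)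
qed

lemma sk_mult_uminus_right:
  assumes "f \<in> sk_carrier n" "g \<in> sk_carrier n"
  shows "sk_mult p n f (- g) = - sk_mult p n f g"
proof
  fix a show "sk_mult p n f (- g) a = (- sk_mult p n f g) a"
    using assms
    by (cases "a \<in> exps n") (simp_all add: sk_mult_eval sk_mult_outside sk_carrier_uminus sum_negf)
qed

lemma sk_mult_diff_left:
  assumes "f \<in> sk_carrier n" "g \<in> sk_carrier n" "h \<in> sk_carrier n"
  shows "sk_mult p n (f - g) h = sk_mult p n f h - sk_mult p n g h"
  using sk_mult_add_left[of f n "- g" h p] sk_mult_uminus_left[of g n h p] assms
  by (simp add: sk_carrier_uminus)

lemma sk_mult_diff_right:
  assumes "f \<in> sk_carrier n" "g \<in> sk_carrier n" "h \<in> sk_carrier n"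
  shows "sk_mult p n f (g - h) = sk_mult p n f g - sk_mult p n f h"
  using sk_mult_add_right[of f n g "- h" p] sk_mult_uminus_right[of f n h p] assms
  by (simp add: sk_carrier_uminus)

lemma sk_twist_0 [simp]: "sk_twist p n 0 c = 1" "sk_twist p n b 0 = 1"
  by (simp_all add: sk_twist_def)

lemma sk_mult_mono_mono:
  "sk_mult p n (sk_mono a u) (sk_mono b v) = sk_mono (a + b) (sk_twist p n a b * u * v)"
proof
  fix x
  have "{(b', c). sk_mono a u b' \<noteq> 0 \<and> sk_mono b v c \<noteq> 0 \<and> (\<lambda>i. b' i + c i) = x} =
    (if u \<noteq> 0 \<and> v \<noteq> 0 \<and> x = a + b then {(a, b)} else {})"
    by (auto simp: sk_mono_def plus_fun_def split: if_splits)
  then show "sk_mult p n (sk_mono a u) (sk_mono b v) x = sk_mono (a + b) (sk_twist p n a b * u * v) x"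
    by (auto simp: sk_mult_def sk_mono_def)
qed

lemma sk_mult_const:
  assumes "f \<in> sk_carrier n"
  shows "sk_mult p n (sk_const c) f = (\<lambda>a. c * f a)"
proof
  fix a
  show "sk_mult p n (sk_const c) f a = c * f a"
  proof (cases "a \<in> exps n")
    case True
    have "sk_mult p n (sk_const c) f a = (\<Sum>b | b \<le> a. if b = 0 then c * f a else 0)"
      using True
      by (subst sk_mult_eval) (simp_all, auto simp: sk_const_mono sk_mono_def intro!: sum.cong)
    also have "\<dots> = c * f a"
      using finite_exps_le[OF True] by (simp add: sum.delta le_fun_def)
    finally show ?thesis .
  next
    case False
    then show ?thesis using assms by (simp add: sk_mult_outside sk_carrier_eq_0)
  qed
qed

lemma sk_carrier_scale: "f \<in> sk_carrier n \<Longrightarrow> (\<lambda>a. c * f a) \<in> sk_carrier n"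
  \<comment> \<open>Scaling is a product with a constant whatever the parameters are; the constant
    family 1 is one choice.\<close>
  using sk_mult_closed[of "sk_const c" n f "\<lambda>_ _. 1"] by (simp add: sk_mult_const)

text \<open>Nothing but 0 lies below the exponent 0, so taking the constant term is a character of
  the ring.\<close>

lemma sk_mult_coeff_0:
  assumes "f \<in> sk_carrier n"
  shows "sk_mult p n f g 0 = f 0 * g 0"
proof -
  have "{b. b \<le> (0 :: nat \<Rightarrow> nat)} = {0}" by (auto simp: le_fun_def fun_eq_iff)
  then show ?thesis using assms by (simp add: sk_mult_eval)
qed

lemma exps_le_unit_exp: "{b. b \<le> unit_exp i} = {0, unit_exp i}"
proof -
  have "b = 0 \<or> b = unit_exp i" if "b \<le> unit_exp i" for b
  proof (cases "b i = 0")
    case True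
    then have "b j = 0" for j
      using le_funD[OF that, of j] by (cases "j = i") (auto simp: unit_exp_def)
    then show ?thesis by (simp add: fun_eq_iff)
  next
    case False
    then have "b j = unit_exp i j" for j
      using le_funD[OF that, of j] by (cases "j = i") (auto simp: unit_exp_def)
    then show ?thesis by (simp add: fun_eq_iff)
  qed
  then show ?thesis by (auto simp: le_fun_def)
qed

text \<open>Leibniz rule for linear coefficients: \<open>unit_exp i\<close> splits only with 0 as
  one part, and there the twist is 1.\<close>

lemma sk_mult_coeff_1:
  assumes "f \<in> sk_carrier n" "i < n"
  shows "sk_mult p n f g (unit_exp i) = f 0 * g (unit_exp i) + f (unit_exp i) * g 0"
  using assms by (simp add: sk_mult_eval exps_le_unit_exp)

section \<open>Filtration by degree\<close>

lemma sk_ge_carrier: "f \<in> sk_ge n d \<Longrightarrow> f \<in> sk_carrier n"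
  by (simp add: sk_ge_def)

lemma sk_ge_coeff: "f \<in> sk_ge n d \<Longrightarrow> mdeg n a < d \<Longrightarrow> f a = 0"
  by (auto simp: sk_ge_def)

lemma sk_ge_antimono: "f \<in> sk_ge n d \<Longrightarrow> e \<le> d \<Longrightarrow> f \<in> sk_ge n e"
  by (auto simp: sk_ge_def)

lemma sk_ge_0: "sk_ge n 0 = sk_carrier n"
  by (simp add: sk_ge_def)

lemma zero_sk_ge [simp]: "0 \<in> sk_ge n d"
  by (simp add: sk_ge_def)

lemma sk_ge_add:
  assumes "f \<in> sk_ge n d" "g \<in> sk_ge n d" shows "f + g \<in> sk_ge n d"
proof -
  have "d \<le> mdeg n a" if "(f + g) a \<noteq> 0" for a
    using that assms by (cases "f a = 0") (auto simp: sk_ge_def)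
  then show ?thesis using assms by (auto simp: sk_ge_def sk_carrier_add)
qed

lemma sk_ge_uminus: "f \<in> sk_ge n d \<Longrightarrow> - f \<in> sk_ge n d"
  by (simp add: sk_ge_def sk_carrier_uminus)

lemma sk_ge_mult:
  assumes "f \<in> sk_ge n d" "g \<in> sk_ge n e" shows "sk_mult p n f g \<in> sk_ge n (d + e)"
proof -
  have "d + e \<le> mdeg n a" if "sk_mult p n f g a \<noteq> 0" for a
    using that by (rule sk_mult_nonzeroD) (use assms in \<open>auto simp: sk_ge_def mdeg_add add_mono\<close>)
  then show ?thesis using assms by (auto simp: sk_ge_def sk_mult_closed)
qed

lemma sk_ge_scale: "f \<in> sk_ge n d \<Longrightarrow> (\<lambda>a. c * f a) \<in> sk_ge n d"
  by (auto simp: sk_ge_def sk_carrier_scale)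

lemma sk_var_ge: "i < n \<Longrightarrow> sk_var i \<in> sk_ge n 1"
  by (auto simp: sk_ge_def) (auto simp: sk_var_mono sk_mono_def split: if_splits)

lemma sk_ge_1_iff: "f \<in> sk_ge n 1 \<longleftrightarrow> f \<in> sk_carrier n \<and> f 0 = 0"
proof -
  have "1 \<le> mdeg n a" if "f \<in> sk_carrier n" "f 0 = 0" "f a \<noteq> 0" for a
    using that mdeg_eq_0[of a n] by (cases "mdeg n a") (auto simp: sk_carrier_iff)
  then show ?thesis by (auto simp: sk_ge_def)
qed

lemma mdeg_eq_1:
  assumes "a \<in> exps n" "mdeg n a = 1"
  obtains i where "i < n" "a = unit_exp i"
proof -
  obtain i where i: "i < n" "0 < a i"
    using assms(2) mdeg_pos[of n a] by auto
  then have "unit_exp i \<le> a" by (simp add: unit_exp_le_iff)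
  then have "mdeg n (a - unit_exp i) = 0" using mdeg_diff[of "unit_exp i" a n] assms i by simp
  then have "a - unit_exp i = 0" using assms(1) by (simp add: mdeg_eq_0 exps_minus)
  then have "a = unit_exp i" using add_diff_exp[OF \<open>unit_exp i \<le> a\<close>] by simp
  with i that show ?thesis by blast
qed

lemma sk_ge_2_iff:
  "f \<in> sk_ge n 2 \<longleftrightarrow> f \<in> sk_carrier n \<and> f 0 = 0 \<and> (\<forall>i<n. f (unit_exp i) = 0)"
proof
  assume "f \<in> sk_ge n 2"
  then show "f \<in> sk_carrier n \<and> f 0 = 0 \<and> (\<forall>i<n. f (unit_exp i) = 0)"
    using sk_ge_coeff[of f n 2] by (auto simp: sk_ge_carrier)
next
  assume f: "f \<in> sk_carrier n \<and> f 0 = 0 \<and> (\<forall>i<n. f (unit_exp i) = 0)"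
  then have "f \<in> sk_ge n 1" unfolding sk_ge_1_iff by blast
  moreover have "2 \<le> mdeg n a" if "f a \<noteq> 0" for a
  proof -
    have "mdeg n a \<noteq> 0" using \<open>f \<in> sk_ge n 1\<close> that by (auto simp: sk_ge_def)
    moreover have "mdeg n a \<noteq> 1"
    proof
      assume "mdeg n a = 1"
      moreover have "a \<in> exps n" using that f sk_carrier_eq_0 by blast
      ultimately show False using that f mdeg_eq_1[of a n] by metis
    qed
    ultimately show ?thesis by linarith
  qed
  ultimately show "f \<in> sk_ge n 2" by (simp add: sk_ge_def)
qed

section \<open>Induction principles and generation by the variables\<close>

text \<open>Adds the terms of \<open>f\<close> one at a time. The premise \<open>f a = u\<close>
  with \<open>u\<close> nonzero keeps every added monomial in the support of the original
  \<open>f\<close>, so degree bounds on \<open>f\<close> remain available in the step.\<close>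

lemma sk_carrier_mono_induct [consumes 1, case_names zero mono]:
  assumes "f \<in> sk_carrier n" and "P 0"
    and "\<And>a u g. f a = u \<Longrightarrow> u \<noteq> 0 \<Longrightarrow> a \<in> exps n \<Longrightarrow> P g \<Longrightarrow> P (sk_mono a u + g)"
  shows "P f"
proof -
  have "P (\<lambda>a. if a \<in> S then f a else 0)" if "finite S" "S \<subseteq> {a. f a \<noteq> 0}" for S
    using that
  proof (induction S)
    case empty
    then show ?case using assms(2) by (simp add: zero_fun_def)
  next
    case (insert a S)
    have "(\<lambda>b. if b \<in> insert a S then f b else 0) = sk_mono a (f a) + (\<lambda>b. if b \<in> S then f b else 0)"
      using insert by (intro ext) (simp add: sk_mono_def)
    moreover have "P (sk_mono a (f a) + (\<lambda>b. if b \<in> S then f b else 0))"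
      using insert assms(1,3) by (auto simp: sk_carrier_iff)
    ultimately show ?case by simp
  qed
  from this[of "{a. f a \<noteq> 0}"] assms(1) have "P (\<lambda>a. if f a \<noteq> 0 then f a else 0)"
    by (simp add: sk_carrier_iff)
  moreover have "(\<lambda>a. if f a \<noteq> 0 then f a else 0) = f" by auto
  ultimately show ?thesis by simp
qed

lemma skew_params_nonzero: "skew_params n p \<Longrightarrow> i < n \<Longrightarrow> j < n \<Longrightarrow> p i j \<noteq> 0"
  and skew_params_swap: "skew_params n p \<Longrightarrow> i < n \<Longrightarrow> j < n \<Longrightarrow> p i j * p j i = 1"
  and skew_params_self: "skew_params n p \<Longrightarrow> i < n \<Longrightarrow> p i i = 1"
  unfolding skew_params_def by (blast, metis right_inverse, blast)

lemma sk_twist_nonzero: "skew_params n p \<Longrightarrow> sk_twist p n b c \<noteq> 0"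
  by (auto simp: sk_twist_def skew_params_nonzero)

text \<open>Moving one x_i to the far left costs a nonzero twist, which is divided out of the
  coefficient.\<close>

lemma sk_mono_factor:
  assumes "skew_params n p" "i < n" "0 < a i"
  shows "sk_mono a u = sk_mult p n (sk_var i)
    (sk_mono (a - unit_exp i) (u / sk_twist p n (unit_exp i) (a - unit_exp i)))"
  using assms sk_twist_nonzero[OF assms(1)]
  by (simp add: sk_var_mono sk_mult_mono_mono unit_exp_le_iff add_diff_exp)

text \<open>The filtration step d + 1 is additively generated by the products of a variable with an
  element of step d. This lets statements about the filtration be proved by induction on d.\<close>

lemma sk_ge_Suc_induct [consumes 2, case_names zero add mult]:
  assumes "f \<in> sk_ge n (Suc d)" and "skew_params n p" and "P 0"
    and "\<And>f g. P f \<Longrightarrow> P g \<Longrightarrow> P (f + g)"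
    and "\<And>i h. i < n \<Longrightarrow> h \<in> sk_ge n d \<Longrightarrow> P (sk_mult p n (sk_var i) h)"
  shows "P f"
  using sk_ge_carrier[OF assms(1)]
proof (induction rule: sk_carrier_mono_induct)
  case zero
  show ?case by fact
next
  case (mono a u g)
  have deg: "Suc d \<le> mdeg n a" using assms(1) mono by (auto simp: sk_ge_def)
  then obtain i where i: "i < n" "0 < a i"
    using mdeg_pos[of n a] by auto
  then have le: "unit_exp i \<le> a" by (simp add: unit_exp_le_iff)
  have "d \<le> mdeg n (a - unit_exp i)" using deg mdeg_diff[OF le, of n] i by simp
  then have "sk_mono (a - unit_exp i) v \<in> sk_ge n d" for v
    using mono(3) by (auto simp: sk_ge_def sk_mono_closed exps_minus) (simp add: sk_mono_def split: if_splits)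
  then have "P (sk_mono a u)"
    unfolding sk_mono_factor[of n p i a u, OF assms(2) i] using i assms(5) by blast
  then show ?case using mono assms(4) by blast
qed

text \<open>The variables generate the algebra: monomials are built by induction on the degree,
  peeling off a variable on the left, and then added up.\<close>

lemma sk_carrier_gen_induct [consumes 2, case_names const add mult]:
  fixes f :: "'k::field skpoly"
  assumes "f \<in> sk_carrier n" and "skew_params n p" and const: "\<And>c. P (sk_const c)"
    and add: "\<And>f g. P f \<Longrightarrow> P g \<Longrightarrow> P (f + g)"
    and mult: "\<And>i h. i < n \<Longrightarrow> h \<in> sk_carrier n \<Longrightarrow> P h \<Longrightarrow> P (sk_mult p n (sk_var i) h)"
  shows "P f"
proof -
  have monomial: "P (sk_mono a u)" if "a \<in> exps n" "mdeg n a = d" for a u d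
    using that
  proof (induction d arbitrary: a u)
    case 0
    then have "a = 0" by (simp only: mdeg_eq_0)
    then show ?case using const[of u] by (simp only: sk_const_mono)
  next
    case (Suc d)
    then obtain i where i: "i < n" "0 < a i"
      using mdeg_pos[of n a] by auto
    then have le: "unit_exp i \<le> a" by (simp add: unit_exp_le_iff)
    have "mdeg n (a - unit_exp i) = d" using Suc.prems mdeg_diff[OF le, of n] i by simp
    then have *: "P (sk_mono (a - unit_exp i) v)" for v
      using Suc.IH Suc.prems by (blast intro: exps_minus)
    then show ?case
      unfolding sk_mono_factor[of n p i a u, OF assms(2) i] using Suc.prems
      by (intro mult i * sk_mono_closed exps_minus)
  qed
  show ?thesis using assms(1)
  proof (induction rule: sk_carrier_mono_induct)
    case zero
    show ?case using const[of 0] by (simp only: sk_const_0)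
  next
    case (mono a u g)
    then show ?case using monomial add by blast
  qed
qed

section \<open>Monomial substitutions\<close>

text \<open>Addition and zero of the record become the pointwise operations on functions, so that
  ordinary simplification for additive groups applies.\<close>

lemma skew_ring_sel:
  "carrier (skew_ring p n) = sk_carrier n" "monoid.mult (skew_ring p n) = sk_mult p n"
  "ring.add (skew_ring p n) = (+)" "ring.zero (skew_ring p n) = 0" "monoid.one (skew_ring p n) = sk_const 1"
  by (auto simp: skew_ring_def plus_fun_def zero_fun_def fun_eq_iff)

text \<open>Groups the square into its diagonal and the pairs of mirrored off-diagonal entries;
  \<open>weight_add\<close> compares such pairs.\<close>

lemma prod_square_split:
  fixes F :: "nat \<Rightarrow> nat \<Rightarrow> 'a::comm_monoid_mult"
  shows "(\<Prod>i<n. \<Prod>j<n. F i j) = (\<Prod>i<n. F i i * (\<Prod>j<i. F i j * F j i))"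
proof (induction n)
  case (Suc n)
  have "(\<Prod>i<Suc n. \<Prod>j<Suc n. F i j) = (\<Prod>i<n. \<Prod>j<n. F i j) * (\<Prod>i<n. F i n) * ((\<Prod>j<n. F n j) * F n n)"
    by (simp add: prod.distrib mult_ac)
  then show ?case using Suc by (simp add: prod.distrib mult_ac)
qed simp

text \<open>The scalar by which x_i x_j differs from the ordered monomial.\<close>
definition swap_factor :: "(nat \<Rightarrow> nat \<Rightarrow> 'k::field) \<Rightarrow> nat \<Rightarrow> nat \<Rightarrow> 'k" where
  "swap_factor p i j = (if j < i then p j i else 1)"

text \<open>The factors added to fill the square are 1. Unlike the triangle j < i, the full square
  can be reindexed by a permutation.\<close>

lemma sk_twist_swap_factor:
  "sk_twist p n b c = (\<Prod>i<n. \<Prod>j<n. swap_factor p i j ^ (b i * c j))"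
proof -
  have "(\<Prod>j<i. p j i ^ (b i * c j)) = (\<Prod>j<n. swap_factor p i j ^ (b i * c j))" if "i < n" for i
  proof -
    have "(\<Prod>j<i. p j i ^ (b i * c j)) = (\<Prod>j<i. swap_factor p i j ^ (b i * c j))"
      by (simp add: swap_factor_def)
    also have "\<dots> = (\<Prod>j<n. swap_factor p i j ^ (b i * c j))"
      using that by (intro prod.mono_neutral_left) (auto simp: swap_factor_def)
    finally show ?thesis .
  qed
  then show ?thesis by (simp add: sk_twist_def)
qed

text \<open>Powers of a single variable need no reordering, so no twist appears.\<close>

lemma sk_pow_scaled_var:
  assumes "s < n"
  shows "sk_pow p n (\<lambda>a. c * sk_var s a) k = sk_mono (\<lambda>j. if j = s then k else 0) (c ^ k)"
proof (induction k)
  case 0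
  show ?case by (simp add: sk_const_def sk_mono_def)
next
  case (Suc k)
  have "(\<lambda>a. c * sk_var s a) = sk_mono (unit_exp s) c"
    by (auto simp: sk_var_mono sk_mono_def)
  moreover have "sk_twist p n (\<lambda>j. if j = s then k else 0) (unit_exp s) = 1"
    by (auto simp: sk_twist_def unit_exp_def intro!: prod.neutral)
  moreover have "(\<lambda>j. if j = s then k else 0) + unit_exp s = (\<lambda>j. if j = s then Suc k else 0)"
    by (auto simp: unit_exp_def fun_eq_iff)
  ultimately show ?case using Suc by (simp add: sk_mult_mono_mono mult.commute)
qed

text \<open>Data of the graded map x_i to c_i x_(\<sigma> i). It goes from the ring with parameters
  \<open>p'\<close> to the ring with parameters \<open>p\<close>, i.e. from the cover of B to the
  cover of A.\<close>

locale monomial_subst =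
  fixes p p' :: "nat \<Rightarrow> nat \<Rightarrow> 'k::field" and n :: nat and \<sigma> :: "nat \<Rightarrow> nat" and c :: "nat \<Rightarrow> 'k"
  assumes params: "skew_params n p" and params': "skew_params n p'"
    and perm: "\<sigma> permutes {..<n}"
    and param_eq: "\<And>i j. i < n \<Longrightarrow> j < n \<Longrightarrow> p' i j = p (\<sigma> i) (\<sigma> j)"
    and c_nonzero: "\<And>i. i < n \<Longrightarrow> c i \<noteq> 0"
begin

text \<open>The coefficient picked up by the monomial x^a (restricted to its first k variables) when its
  image is brought back to ordered form.\<close>
definition weight :: "nat \<Rightarrow> (nat \<Rightarrow> nat) \<Rightarrow> 'k" where
  "weight k a = (\<Prod>i<k. c i ^ a i) * (\<Prod>i<k. \<Prod>l<i. swap_factor p (\<sigma> l) (\<sigma> i) ^ (a l * a i))"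

abbreviation \<tau> :: "nat \<Rightarrow> nat" where
  "\<tau> \<equiv> inv_into UNIV \<sigma>"

abbreviation \<Phi> :: "'k skpoly \<Rightarrow> 'k skpoly" where
  "\<Phi> \<equiv> sk_subst p n n (\<lambda>i a. c i * sk_var (\<sigma> i) a)"

lemma sigma_less: "i < n \<Longrightarrow> \<sigma> i < n"
  using permutes_in_image[OF perm, of i] by simp

lemma swap_factor_nonzero: "i < n \<Longrightarrow> j < n \<Longrightarrow> swap_factor p i j \<noteq> 0"
  by (simp add: swap_factor_def skew_params_nonzero[OF params])

lemma weight_nonzero: "weight n a \<noteq> 0"
  by (auto simp: weight_def c_nonzero swap_factor_nonzero sigma_less)

lemma inv_sigma: "\<tau> (\<sigma> i) = i" "\<sigma> (\<tau> i) = i"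
  using permutes_inverses[OF perm] by auto

lemma comp_inv_sigma: "(a \<circ> \<tau>) \<circ> \<sigma> = a" "(a \<circ> \<sigma>) \<circ> \<tau> = a"
  by (auto simp: inv_sigma fun_eq_iff)

text \<open>Induction on the number \<open>k\<close> of factors already multiplied. Their product is
  a monomial in the variables x_(\<sigma> i) with i < k, whence the truncation of the
  exponent.\<close>

lemma mono_image_prefix:
  assumes "k \<le> n"
  shows "foldl (\<lambda>acc i. sk_mult p n acc (sk_pow p n (\<lambda>b. c i * sk_var (\<sigma> i) b) (a i))) (sk_const 1) [0..<k] =
    sk_mono (\<lambda>s. if \<tau> s < k then a (\<tau> s) else 0) (weight k a)"
  using assms
proof (induction k)
  case 0
  show ?case by (simp add: sk_const_def sk_mono_def weight_def)
next
  case (Suc k)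
  let ?b = "\<lambda>s. if \<tau> s < k then a (\<tau> s) else 0"
  let ?e = "\<lambda>j. if j = \<sigma> k then a k else 0"
  have k: "\<sigma> k < n" using Suc.prems sigma_less by simp
  \<comment> \<open>The appended factor is a power of x_(\<sigma> k) alone, so only the column
    \<open>\<sigma> k\<close> of the square survives.\<close>
  have "sk_twist p n ?b ?e = (\<Prod>i<n. swap_factor p i (\<sigma> k) ^ (?b i * a k))"
  proof -
    have "(\<Prod>j<n. swap_factor p i j ^ (?b i * ?e j)) = swap_factor p i (\<sigma> k) ^ (?b i * a k)" for i
    proof -
      have "(\<Prod>j<n. swap_factor p i j ^ (?b i * ?e j)) =
          (\<Prod>j<n. if j = \<sigma> k then swap_factor p i (\<sigma> k) ^ (?b i * a k) else 1)"
        by (intro prod.cong) auto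
      then show ?thesis using k by (simp add: prod.delta)
    qed
    then show ?thesis by (simp add: sk_twist_swap_factor)
  qed
  \<comment> \<open>Reindexing by \<sigma> lists the variables in the order of the product; those
    with l \<ge> k have not occurred yet and drop out.\<close>
  also have "\<dots> = (\<Prod>l<n. swap_factor p (\<sigma> l) (\<sigma> k) ^ (?b (\<sigma> l) * a k))"
    using prod.permute[OF perm, of "\<lambda>i. swap_factor p i (\<sigma> k) ^ (?b i * a k)"] by (simp add: o_def)
  also have "\<dots> = (\<Prod>l<k. swap_factor p (\<sigma> l) (\<sigma> k) ^ (?b (\<sigma> l) * a k))"
    using Suc.prems by (intro prod.mono_neutral_right) (auto simp: inv_sigma)
  also have "\<dots> = (\<Prod>l<k. swap_factor p (\<sigma> l) (\<sigma> k) ^ (a l * a k))"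
    by (simp add: inv_sigma)
  finally have tw: "sk_twist p n ?b ?e = (\<Prod>l<k. swap_factor p (\<sigma> l) (\<sigma> k) ^ (a l * a k))" .
  have "?b + ?e = (\<lambda>s. if \<tau> s < Suc k then a (\<tau> s) else 0)"
  proof
    fix s show "(?b + ?e) s = (if \<tau> s < Suc k then a (\<tau> s) else 0)"
      using inv_sigma(1)[of k] inv_sigma(2)[of s] by (auto simp: less_Suc_eq)
  qed
  then show ?case using Suc tw
    by (simp add: sk_pow_scaled_var[OF k] sk_mult_mono_mono weight_def mult_ac)
qed

lemma mono_image:
  assumes "a \<in> exps n"
  shows "sk_mono_image p n n (\<lambda>i b. c i * sk_var (\<sigma> i) b) a = sk_mono (a \<circ> \<tau>) (weight n a)"
proof -
  have "(if \<tau> s < n then a (\<tau> s) else 0) = (a \<circ> \<tau>) s" for s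
    using assms by (simp add: exps_def)
  then have "(\<lambda>s. if \<tau> s < n then a (\<tau> s) else 0) = a \<circ> \<tau>" by (rule ext)
  then show ?thesis by (simp only: sk_mono_image_def mono_image_prefix order_refl)
qed

text \<open>Distinct monomials have proportional images to distinct monomials, so the sum defining
  the substitution collapses to one term. All later properties of \<open>\<Phi>\<close> are read off
  from this pointwise formula.\<close>

lemma \<Phi>_eval:
  assumes "f \<in> sk_carrier n"
  shows "\<Phi> f b = f (b \<circ> \<sigma>) * weight n (b \<circ> \<sigma>)"
proof -
  have iff: "b = a \<circ> \<tau> \<longleftrightarrow> a = b \<circ> \<sigma>" for a
    by (metis comp_inv_sigma)
  have "\<Phi> f b = (\<Sum>a | f a \<noteq> 0. if a = b \<circ> \<sigma> then f a * weight n a else 0)"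
    unfolding sk_subst_def
  proof (rule sum.cong)
    fix a assume "a \<in> {a. f a \<noteq> 0}"
    then have "a \<in> exps n" using assms sk_carrier_eq_0 by blast
    then show "f a * sk_mono_image p n n (\<lambda>i b. c i * sk_var (\<sigma> i) b) a b =
        (if a = b \<circ> \<sigma> then f a * weight n a else 0)"
      by (simp add: mono_image sk_mono_def iff)
  qed simp
  also have "\<dots> = f (b \<circ> \<sigma>) * weight n (b \<circ> \<sigma>)"
    using assms by (simp add: sk_carrier_iff sum.delta)
  finally show ?thesis .
qed

section \<open>The substitution as a graded ring isomorphism\<close>

lemma exps_comp: "b \<circ> \<sigma> \<in> exps n \<longleftrightarrow> b \<in> exps n"
proof -
  have "i \<ge> n \<Longrightarrow> \<sigma> i = i" for i using permutes_not_in[OF perm, of i] by simp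
  then show ?thesis by (simp add: exps_def)
qed

lemma mdeg_comp: "mdeg n (b \<circ> \<sigma>) = mdeg n b"
  using sum.permute[OF perm, of b] by (simp add: mdeg_def)

lemma \<Phi>_carrier:
  assumes "f \<in> sk_carrier n" shows "\<Phi> f \<in> sk_carrier n"
proof -
  have "{b. \<Phi> f b \<noteq> 0} \<subseteq> (\<lambda>a. a \<circ> \<tau>) ` {a. f a \<noteq> 0}"
  proof
    fix b assume "b \<in> {b. \<Phi> f b \<noteq> 0}"
    then have "f (b \<circ> \<sigma>) \<noteq> 0" using assms by (simp add: \<Phi>_eval)
    then show "b \<in> (\<lambda>a. a \<circ> \<tau>) ` {a. f a \<noteq> 0}"
      by (intro image_eqI[where x = "b \<circ> \<sigma>"]) (simp_all add: comp_inv_sigma)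
  qed
  then have "finite {b. \<Phi> f b \<noteq> 0}"
    by (rule finite_surj[rotated]) (use assms in \<open>simp add: sk_carrier_iff\<close>)
  moreover have "b \<in> exps n" if "\<Phi> f b \<noteq> 0" for b
    using that assms sk_carrier_eq_0[OF assms, of "b \<circ> \<sigma>"] by (auto simp: \<Phi>_eval exps_comp)
  ultimately show ?thesis by (auto simp: sk_carrier_iff)
qed

lemma \<Phi>_add:
  assumes "f \<in> sk_carrier n" "g \<in> sk_carrier n" shows "\<Phi> (f + g) = \<Phi> f + \<Phi> g"
  using assms by (intro ext) (simp add: \<Phi>_eval sk_carrier_add algebra_simps)

lemma \<Phi>_ge:
  assumes "f \<in> sk_ge n d" shows "\<Phi> f \<in> sk_ge n d"
  using assms \<Phi>_carrier[of f] by (auto simp: sk_ge_def \<Phi>_eval mdeg_comp dest: spec[of _ "_ \<circ> \<sigma>"])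

lemma \<Phi>_hom_comp:
  assumes "f \<in> sk_carrier n" "hom_comp n d f \<in> sk_carrier n"
  shows "\<Phi> (hom_comp n d f) = hom_comp n d (\<Phi> f)"
  using assms by (intro ext) (simp add: \<Phi>_eval hom_comp_def mdeg_comp)

lemma \<Phi>_var: "i < n \<Longrightarrow> \<Phi> (sk_var i) = (\<lambda>a. c i * sk_var (\<sigma> i) a)"
proof
  fix b assume i: "i < n"
  have iff: "b \<circ> \<sigma> = unit_exp i \<longleftrightarrow> b = unit_exp (\<sigma> i)"
  proof -
    have "unit_exp i = unit_exp (\<sigma> i) \<circ> \<sigma>"
      by (auto simp: fun_eq_iff unit_exp_def inv_sigma dest: arg_cong[of _ _ "\<tau>"])
    then show ?thesis by (metis comp_inv_sigma(2))
  qed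
  have "weight n (unit_exp i) = c i"
  proof -
    have "(\<Prod>j<n. c j ^ unit_exp i j) = (\<Prod>j<n. if j = i then c i else 1)"
      by (intro prod.cong) (auto simp: unit_exp_def)
    then have "(\<Prod>j<n. c j ^ unit_exp i j) = c i" using i by (simp add: prod.delta)
    \<comment> \<open>For l < j at most one of the two exponents is nonzero.\<close>
    moreover have "(\<Prod>j<n. \<Prod>l<j. swap_factor p (\<sigma> l) (\<sigma> j) ^ (unit_exp i l * unit_exp i j)) = 1"
      by (intro prod.neutral ballI) (simp add: unit_exp_def)
    ultimately show ?thesis by (simp add: weight_def)
  qed
  then have "sk_var i (b \<circ> \<sigma>) * weight n (b \<circ> \<sigma>) = c i * sk_var (\<sigma> i) b"
    by (cases "b \<circ> \<sigma> = unit_exp i") (simp_all only: sk_var_mono sk_mono_def iff[symmetric], simp_all)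
  then show "\<Phi> (sk_var i) b = c i * sk_var (\<sigma> i) b"
    using i by (simp add: \<Phi>_eval)
qed

lemma \<Phi>_const: "\<Phi> (sk_const u) = sk_const u"
proof
  fix b :: "nat \<Rightarrow> nat"
  have "b \<circ> \<sigma> = 0 \<longleftrightarrow> b = 0"
    using comp_inv_sigma(2)[of b] by (auto simp: fun_eq_iff)
  moreover have "weight n 0 = 1" by (simp add: weight_def)
  ultimately show "\<Phi> (sk_const u) b = sk_const u b"
    by (simp add: \<Phi>_eval) (auto simp: sk_const_mono sk_mono_def)
qed

text \<open>Says that the two twists differ by the coboundary of \<open>weight\<close>; this is
  precisely multiplicativity of \<open>\<Phi>\<close> on monomials.\<close>

lemma weight_add:
  "weight n a * weight n b * sk_twist p n (a \<circ> \<tau>) (b \<circ> \<tau>) = weight n (a + b) * sk_twist p' n a b"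
proof -
  let ?r = "\<lambda>l i. swap_factor p (\<sigma> l) (\<sigma> i)"
  \<comment> \<open>The compatibility of the parameters enters here: exchanging the images of x_l
    and x_i costs the parameter of the source ring.\<close>
  have r: "?r i l = p' l i * ?r l i" if "l < i" "i < n" for i l
    using that param_eq[of l i] skew_params_swap[OF params, of "\<sigma> l" "\<sigma> i"] sigma_less[of l] sigma_less[of i]
      inv_sigma(1)[of i] inv_sigma(1)[of l]
    by (cases "\<sigma> l" "\<sigma> i" rule: linorder_cases) (auto simp: swap_factor_def)
  have "sk_twist p n (a \<circ> \<tau>) (b \<circ> \<tau>) =
      (\<Prod>i<n. \<Prod>j<n. swap_factor p i j ^ (a (\<tau> i) * b (\<tau> j)))"
    by (simp add: sk_twist_swap_factor)
  also have "\<dots> = (\<Prod>i<n. \<Prod>j<n. swap_factor p (\<sigma> i) j ^ (a i * b (\<tau> j)))"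
    using prod.permute[OF perm, of "\<lambda>i. \<Prod>j<n. swap_factor p i j ^ (a (\<tau> i) * b (\<tau> j))"]
    by (simp add: o_def inv_sigma)
  also have "\<dots> = (\<Prod>i<n. \<Prod>j<n. ?r i j ^ (a i * b j))"
  proof (rule prod.cong)
    fix i
    show "(\<Prod>j<n. swap_factor p (\<sigma> i) j ^ (a i * b (\<tau> j))) = (\<Prod>j<n. ?r i j ^ (a i * b j))"
      using prod.permute[OF perm, of "\<lambda>j. swap_factor p (\<sigma> i) j ^ (a i * b (\<tau> j))"]
      by (simp add: o_def inv_sigma)
  qed simp
  also have "\<dots> = (\<Prod>i<n. \<Prod>l<i. ?r i l ^ (a i * b l) * ?r l i ^ (a l * b i))"
    by (subst prod_square_split) (simp add: swap_factor_def)
  also have "\<dots> = (\<Prod>i<n. \<Prod>l<i. p' l i ^ (a i * b l) * (?r l i ^ (a i * b l) * ?r l i ^ (a l * b i)))"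
    by (intro prod.cong) (auto simp: r power_mult_distrib mult_ac)
  also have "\<dots> = sk_twist p' n a b * (\<Prod>i<n. \<Prod>l<i. ?r l i ^ (a i * b l) * ?r l i ^ (a l * b i))"
    by (simp add: sk_twist_def prod.distrib)
  finally have tw: "sk_twist p n (a \<circ> \<tau>) (b \<circ> \<tau>) =
      sk_twist p' n a b * (\<Prod>i<n. \<Prod>l<i. ?r l i ^ (a i * b l) * ?r l i ^ (a l * b i))" .
  \<comment> \<open>The exponents in \<open>weight\<close> are quadratic, so what remains are the
    cross terms of (a_l + b_l)(a_i + b_i).\<close>
  have "weight n (a + b) = weight n a * weight n b *
      (\<Prod>i<n. \<Prod>l<i. ?r l i ^ (a i * b l) * ?r l i ^ (a l * b i))"
    unfolding weight_def
    by (simp add: power_add prod.distrib distrib_left distrib_right mult_ac)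
  then show ?thesis by (simp add: tw mult_ac)
qed

text \<open>Composition with \<sigma> matches the splittings of \<open>b\<close> with those of
  \<open>b \<circ> \<sigma>\<close>, after which \<open>weight_add\<close> identifies the two sums
  term by term.\<close>

lemma \<Phi>_mult:
  assumes f: "f \<in> sk_carrier n" and g: "g \<in> sk_carrier n"
  shows "\<Phi> (sk_mult p' n f g) = sk_mult p n (\<Phi> f) (\<Phi> g)"
proof
  fix b
  show "\<Phi> (sk_mult p' n f g) b = sk_mult p n (\<Phi> f) (\<Phi> g) b"
  proof (cases "b \<in> exps n")
    case False
    then show ?thesis using f g
      by (simp add: \<Phi>_eval sk_mult_closed sk_mult_outside \<Phi>_carrier exps_comp)
  next
    case True
    let ?a = "b \<circ> \<sigma>"
    have bij: "bij_betw (\<lambda>x. x \<circ> \<sigma>) {x. x \<le> b} {y. y \<le> ?a}"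
    proof (rule bij_betw_byWitness[where f' = "\<lambda>y. y \<circ> \<tau>"])
      show "(\<lambda>x. x \<circ> \<sigma>) ` {x. x \<le> b} \<subseteq> {y. y \<le> ?a}"
        by (auto simp: le_fun_def)
      show "(\<lambda>y. y \<circ> \<tau>) ` {y. y \<le> ?a} \<subseteq> {x. x \<le> b}"
        by (auto simp: le_fun_def) (metis inv_sigma(2))
    qed (simp_all add: comp_inv_sigma)
    have "\<Phi> (sk_mult p' n f g) b =
        (\<Sum>y | y \<le> ?a. sk_twist p' n y (?a - y) * f y * g (?a - y)) * weight n ?a"
      using True f g by (simp add: \<Phi>_eval sk_mult_closed sk_mult_eval exps_comp)
    also have "\<dots> = (\<Sum>y | y \<le> ?a. sk_twist p' n y (?a - y) * f y * g (?a - y) * weight n ?a)"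
      by (simp add: sum_distrib_right)
    also have "\<dots> = (\<Sum>x | x \<le> b. sk_twist p' n (x \<circ> \<sigma>) (?a - (x \<circ> \<sigma>)) * f (x \<circ> \<sigma>) * g (?a - (x \<circ> \<sigma>)) * weight n ?a)"
      using sum.reindex_bij_betw[OF bij, of "\<lambda>y. sk_twist p' n y (?a - y) * f y * g (?a - y) * weight n ?a"]
      by simp
    also have "\<dots> = (\<Sum>x | x \<le> b. sk_twist p n x (b - x) * \<Phi> f x * \<Phi> g (b - x))"
    proof (rule sum.cong)
      fix x assume "x \<in> {x. x \<le> b}"
      then have x: "x \<le> b" by simp
      let ?u = "x \<circ> \<sigma>" and ?v = "(b - x) \<circ> \<sigma>"
      have v: "?a - ?u = ?v" by (simp add: fun_eq_iff)
      have uv: "?u + ?v = ?a" using le_funD[OF x] by (simp add: fun_eq_iff)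
      have "weight n ?a * sk_twist p' n ?u ?v = weight n ?u * weight n ?v * sk_twist p n x (b - x)"
        using weight_add[of ?u ?v] by (simp only: uv comp_inv_sigma)
      then show "sk_twist p' n ?u (?a - ?u) * f ?u * g (?a - ?u) * weight n ?a =
          sk_twist p n x (b - x) * \<Phi> f x * \<Phi> g (b - x)"
        unfolding v using f g by (simp add: \<Phi>_eval algebra_simps)
    qed simp
    also have "\<dots> = sk_mult p n (\<Phi> f) (\<Phi> g) b"
      using True f by (simp add: sk_mult_eval \<Phi>_carrier)
    finally show ?thesis .
  qed
qed

text \<open>The preimage is explicit: permute the exponents back and divide by the nonzero weight.
  Degrees are unchanged, so it stays in the same filtration step.\<close>

lemma \<Phi>_surj_ge:
  assumes "f \<in> sk_ge n d"
  obtains g where "g \<in> sk_ge n d" "\<Phi> g = f"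
proof -
  let ?g = "\<lambda>a. f (a \<circ> \<tau>) / weight n a"
  have "{a. ?g a \<noteq> 0} \<subseteq> (\<lambda>b. b \<circ> \<sigma>) ` {b. f b \<noteq> 0}"
  proof
    fix a assume "a \<in> {a. ?g a \<noteq> 0}"
    then show "a \<in> (\<lambda>b. b \<circ> \<sigma>) ` {b. f b \<noteq> 0}"
      by (intro image_eqI[where x = "a \<circ> \<tau>"]) (auto simp: comp_inv_sigma)
  qed
  then have fin: "finite {a. ?g a \<noteq> 0}"
    by (rule finite_surj[rotated]) (use sk_ge_carrier[OF assms] in \<open>simp add: sk_carrier_iff\<close>)
  have supp: "a \<in> exps n \<and> d \<le> mdeg n a" if "?g a \<noteq> 0" for a
  proof -
    have "f (a \<circ> \<tau>) \<noteq> 0" using that by auto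
    then have "a \<circ> \<tau> \<in> exps n" "d \<le> mdeg n (a \<circ> \<tau>)"
      using assms sk_carrier_eq_0[OF sk_ge_carrier[OF assms]] by (auto simp: sk_ge_def)
    then show ?thesis
      using exps_comp[of "a \<circ> \<tau>"] mdeg_comp[of "a \<circ> \<tau>"] by (simp only: comp_inv_sigma)
  qed
  have g: "?g \<in> sk_carrier n" unfolding sk_carrier_iff using fin supp by blast
  moreover have "\<Phi> ?g = f"
    by (intro ext) (simp only: \<Phi>_eval[OF g] comp_inv_sigma, simp add: weight_nonzero)
  ultimately show ?thesis using that[of ?g] supp unfolding sk_ge_def by blast
qed

lemma \<Phi>_inj:
  assumes "f \<in> sk_carrier n" "g \<in> sk_carrier n" "\<Phi> f = \<Phi> g" shows "f = g"
proof
  fix a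
  have "\<Phi> f (a \<circ> \<tau>) = \<Phi> g (a \<circ> \<tau>)" using assms by simp
  then show "f a = g a" using assms(1,2) by (simp add: \<Phi>_eval comp_inv_sigma weight_nonzero)
qed

lemma \<Phi>_bij: "bij_betw \<Phi> (sk_carrier n) (sk_carrier n)"
  unfolding bij_betw_def
proof
  show "inj_on \<Phi> (sk_carrier n)" by (rule inj_onI) (rule \<Phi>_inj)
  show "\<Phi> ` sk_carrier n = sk_carrier n"
  proof
    show "\<Phi> ` sk_carrier n \<subseteq> sk_carrier n" using \<Phi>_carrier by blast
    show "sk_carrier n \<subseteq> \<Phi> ` sk_carrier n"
    proof
      fix f :: "'k skpoly" assume "f \<in> sk_carrier n"
      then obtain g where "g \<in> sk_carrier n" "\<Phi> g = f"
        using \<Phi>_surj_ge[of f 0] unfolding sk_ge_0 by blast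
      then show "f \<in> \<Phi> ` sk_carrier n" by blast
    qed
  qed
qed

lemma \<Phi>_ring_iso: "\<Phi> \<in> ring_iso (skew_ring p' n) (skew_ring p n)"
  by (rule ring_iso_memI; unfold skew_ring_sel)
    (fact \<Phi>_carrier \<Phi>_mult \<Phi>_add \<Phi>_const \<Phi>_bij)+

end

section \<open>Correspondences between two quotients\<close>

lemma sum_fun_apply: "(\<Sum>i\<in>A. f i) x = (\<Sum>i\<in>A. f i x)"
  by (induction A rule: infinite_finite_induct) simp_all

lemma sk_twist_unit_exp:
  assumes "i < n" "j < n"
  shows "sk_twist p n (unit_exp i) (unit_exp j) = swap_factor p i j"
proof -
  have "(\<Prod>b<n. swap_factor p a b ^ (unit_exp i a * unit_exp j b)) = swap_factor p a j ^ unit_exp i a" for a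
  proof -
    have "(\<Prod>b<n. swap_factor p a b ^ (unit_exp i a * unit_exp j b)) =
        (\<Prod>b<n. if b = j then swap_factor p a j ^ unit_exp i a else 1)"
      by (intro prod.cong) (auto simp: unit_exp_def)
    then show ?thesis using assms by (simp add: prod.delta)
  qed
  then have "sk_twist p n (unit_exp i) (unit_exp j) = (\<Prod>a<n. if a = i then swap_factor p i j else 1)"
    unfolding sk_twist_swap_factor by (intro prod.cong) (auto simp: unit_exp_def)
  then show ?thesis using assms by (simp add: prod.delta)
qed

lemma swap_factor_swap:
  assumes "skew_params n p" "i < n" "j < n"
  shows "swap_factor p j i = p i j * swap_factor p i j"
  using skew_params_swap[OF assms] skew_params_self[OF assms(1,2)]
  by (cases i j rule: linorder_cases) (auto simp: swap_factor_def)

text \<open>Recovers the defining relations of the skew polynomial ring from the encoding by ordered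
  monomials.\<close>

lemma sk_var_swap:
  assumes "skew_params n p" "i < n" "j < n"
  shows "sk_mult p n (sk_var j) (sk_var i) = (\<lambda>a. p i j * sk_mult p n (sk_var i) (sk_var j) a)"
proof -
  have "sk_mult p n (sk_var j) (sk_var i) = sk_mono (unit_exp i + unit_exp j) (p i j * swap_factor p i j)"
    using assms by (simp add: sk_var_mono sk_mult_mono_mono sk_twist_unit_exp swap_factor_swap[OF assms] add.commute)
  also have "\<dots> = (\<lambda>a. p i j * sk_mono (unit_exp i + unit_exp j) (swap_factor p i j) a)"
    by (intro ext) (simp add: sk_mono_def)
  also have "sk_mono (unit_exp i + unit_exp j) (swap_factor p i j) = sk_mult p n (sk_var i) (sk_var j)"
    using assms by (simp add: sk_var_mono sk_mult_mono_mono sk_twist_unit_exp)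
  finally show ?thesis .
qed

text \<open>Without constant terms only linear times linear contributes in degree 2. For s = t there
  is a single splitting, for distinct s and t there are two, each with its own reordering
  factor.\<close>

lemma sk_mult_coeff_2:
  assumes f: "f \<in> sk_ge n 1" and g: "g \<in> sk_ge n 1" and st: "s < n" "t < n"
  shows "sk_mult p n f g (unit_exp s + unit_exp t) =
    (if s = t then f (unit_exp s) * g (unit_exp s)
     else swap_factor p s t * f (unit_exp s) * g (unit_exp t) + swap_factor p t s * f (unit_exp t) * g (unit_exp s))"
proof -
  let ?a = "unit_exp s + unit_exp t"
  let ?h = "\<lambda>b. sk_twist p n b (?a - b) * f b * g (?a - b)"
  have a: "?a \<in> exps n" using st by (simp add: exps_add)
  have diff: "?a - unit_exp s = unit_exp t" "?a - unit_exp t = unit_exp s"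
    by (simp_all add: fun_eq_iff)
  have "sk_mult p n f g ?a = (\<Sum>b | b \<le> ?a. ?h b)"
    using a f by (simp add: sk_mult_eval sk_ge_carrier)
  \<comment> \<open>Both parts of a contributing splitting have degree at least 1 and their degrees
    add up to 2, so both are unit exponents.\<close>
  also have "\<dots> = (\<Sum>b\<in>{unit_exp s, unit_exp t}. ?h b)"
  proof (rule sum.mono_neutral_right)
    show "finite {b. b \<le> ?a}" by (rule finite_exps_le[OF a])
    show "{unit_exp s, unit_exp t} \<subseteq> {b. b \<le> ?a}" by (auto simp: le_fun_def)
    show "\<forall>b\<in>{b. b \<le> ?a} - {unit_exp s, unit_exp t}. ?h b = 0"
    proof
      fix b assume b: "b \<in> {b. b \<le> ?a} - {unit_exp s, unit_exp t}"
      show "?h b = 0"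
      proof (rule ccontr)
        assume "?h b \<noteq> 0"
        then have "f b \<noteq> 0" "g (?a - b) \<noteq> 0" by auto
        then have "1 \<le> mdeg n b" "1 \<le> mdeg n (?a - b)" using f g by (auto simp: sk_ge_def)
        moreover have "mdeg n ?a = mdeg n b + mdeg n (?a - b)" using b by (intro mdeg_diff) simp
        ultimately have "mdeg n b = 1" using st by (simp add: mdeg_add)
        moreover have "b \<in> exps n" using exps_le[OF a] b by simp
        ultimately obtain i where i: "b = unit_exp i" using mdeg_eq_1 by blast
        then have "0 < ?a i" using b unit_exp_le_iff[of i ?a] by simp
        then have "i = s \<or> i = t" by (auto simp: unit_exp_def split: if_splits)
        with b i show False by auto
      qed
    qed
  qed
  also have "\<dots> = (if s = t then f (unit_exp s) * g (unit_exp s)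
     else swap_factor p s t * f (unit_exp s) * g (unit_exp t) + swap_factor p t s * f (unit_exp t) * g (unit_exp s))"
  proof (cases "s = t")
    case True
    then show ?thesis using diff st by (simp add: sk_twist_unit_exp) (simp add: swap_factor_def)
  next
    case False
    then show ?thesis using diff st by (simp add: sk_twist_unit_exp)
  qed
  finally show ?thesis .
qed

section \<open>Graded ideals and homogeneous components\<close>

lemma sk_ideal:
  assumes "graded_ideal p n I"
  shows sk_ideal_carrier: "f \<in> I \<Longrightarrow> f \<in> sk_carrier n"
    and sk_ideal_zero: "0 \<in> I"
    and sk_ideal_add: "f \<in> I \<Longrightarrow> g \<in> I \<Longrightarrow> f + g \<in> I"
    and sk_ideal_hom_comp: "f \<in> I \<Longrightarrow> hom_comp n d f \<in> I"
proof -
  interpret ideal I "skew_ring p n" using assms by (simp add: graded_ideal_def)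
  show c: "f \<in> I \<Longrightarrow> f \<in> sk_carrier n" for f
    using a_Hcarr[of f] by (simp add: skew_ring_sel)
  show "0 \<in> I" using additive_subgroup.zero_closed[OF is_additive_subgroup] by (simp add: skew_ring_sel)
  show "f \<in> I \<Longrightarrow> g \<in> I \<Longrightarrow> f + g \<in> I"
    using additive_subgroup.a_closed[OF is_additive_subgroup, of f g] by (simp add: skew_ring_sel)
  show "f \<in> I \<Longrightarrow> hom_comp n d f \<in> I"
    using assms by (simp add: graded_ideal_def)
qed

lemma sk_ideal_sum:
  assumes "graded_ideal p n I"
  shows "(\<And>i. i \<in> A \<Longrightarrow> f i \<in> I) \<Longrightarrow> (\<Sum>i\<in>A. f i) \<in> I"
  by (induction A rule: infinite_finite_induct) (simp_all add: sk_ideal_zero[OF assms] sk_ideal_add[OF assms])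

lemma sk_carrier_sum_hom_comp:
  assumes "f \<in> sk_carrier n"
  obtains D where "f = (\<Sum>d<D. hom_comp n d f)"
proof
  \<comment> \<open>The sum of all degrees in the support bounds each of them; \<open>Suc\<close>
    compensates for the strict range d < D.\<close>
  let ?D = "Suc (\<Sum>a | f a \<noteq> 0. mdeg n a)"
  show "f = (\<Sum>d<?D. hom_comp n d f)"
  proof
    fix a
    show "f a = (\<Sum>d<?D. hom_comp n d f) a"
    proof (cases "f a = 0")
      case True
      then have "hom_comp n d f a = 0" for d by (simp add: hom_comp_def)
      then show ?thesis using True by (simp only: sum_fun_apply) simp
    next
      case False
      then have "mdeg n a \<le> (\<Sum>a | f a \<noteq> 0. mdeg n a)"
        using assms by (intro member_le_sum) (auto simp: sk_carrier_iff)
      then have "mdeg n a < ?D" by simp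
      then show ?thesis by (simp only: sum_fun_apply hom_comp_def) (simp add: sum.delta)
    qed
  qed
qed

lemma sk_ideal_memI:
  assumes "graded_ideal p n I" "f \<in> sk_carrier n" "\<And>d. hom_comp n d f \<in> I"
  shows "f \<in> I"
proof -
  obtain D where "f = (\<Sum>d<D. hom_comp n d f)" by (rule sk_carrier_sum_hom_comp[OF assms(2)])
  moreover have "(\<Sum>d<D. hom_comp n d f) \<in> I" by (rule sk_ideal_sum[OF assms(1)]) (rule assms(3))
  ultimately show ?thesis by simp
qed

text \<open>An isomorphism of the quotients, encoded as the relation ``the class of f is mapped to the class
  of g'' between representatives. The two sides then play symmetric roles, so every statement has a
  mirror image.\<close>
locale skew_corr =
  fixes p :: "nat \<Rightarrow> nat \<Rightarrow> 'k::field" and n :: nat and M :: "'k skpoly set"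
    and p' :: "nat \<Rightarrow> nat \<Rightarrow> 'k" and m :: nat and N :: "'k skpoly set"
    and T :: "'k skpoly \<Rightarrow> 'k skpoly \<Rightarrow> bool"
  assumes params: "skew_params n p" and params': "skew_params m p'"
    and graded_M: "graded_ideal p n M" and graded_N: "graded_ideal p' m N"
    and M_ge_2: "M \<subseteq> sk_ge n 2" and N_ge_2: "N \<subseteq> sk_ge m 2"
    and T_left: "T f g \<Longrightarrow> f \<in> sk_carrier n" and T_right: "T f g \<Longrightarrow> g \<in> sk_carrier m"
    and left_total: "f \<in> sk_carrier n \<Longrightarrow> \<exists>g. T f g"
    and right_total: "g \<in> sk_carrier m \<Longrightarrow> \<exists>f. T f g"
    and T_add: "T f g \<Longrightarrow> T f' g' \<Longrightarrow> T (f + f') (g + g')"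
    and T_mult: "T f g \<Longrightarrow> T f' g' \<Longrightarrow> T (sk_mult p n f f') (sk_mult p' m g g')"
    and T_const: "T (sk_const u) (sk_const u)"
    and T_0_left: "T 0 g \<longleftrightarrow> g \<in> N" and T_0_right: "T f 0 \<longleftrightarrow> f \<in> M"
begin

text \<open>The locale asks the same of both sides. The asymmetric hypotheses, parameters distinct
  from 1 and \<open>M\<close> starting in degree 3, are premises of the individual lemmas
  instead.\<close>

lemma swapped: "skew_corr p' m N p n M (\<lambda>g f. T f g)"
  by unfold_locales (fact params params' graded_M graded_N M_ge_2 N_ge_2 T_left T_right left_total
      right_total T_add T_mult T_const T_0_left T_0_right)+

lemma T_scale:
  assumes "T f g" shows "T (\<lambda>a. u * f a) (\<lambda>a. u * g a)"
  using T_mult[OF T_const assms, of u] assms[THEN T_left] assms[THEN T_right]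
  by (simp add: sk_mult_const)

lemma T_diff: "T f g \<Longrightarrow> T f' g' \<Longrightarrow> T (f - f') (g - g')"
  using T_add[of f g "\<lambda>a. - 1 * f' a" "\<lambda>a. - 1 * g' a"] T_scale[of f' g' "- 1"]
  by (simp add: plus_fun_def fun_diff_def)

lemma T_0: "T 0 0"
  by (simp add: T_0_left sk_ideal_zero[OF graded_N])

lemma T_sum: "(\<And>i. i \<in> A \<Longrightarrow> T (f i) (g i)) \<Longrightarrow> T (\<Sum>i\<in>A. f i) (\<Sum>i\<in>A. g i)"
  by (induction A rule: infinite_finite_induct) (simp_all add: T_0 T_add)

lemma T_right_unique: "T f g \<Longrightarrow> T f g' \<Longrightarrow> g - g' \<in> N"
  using T_diff[of f g f g'] by (simp add: T_0_left)

text \<open>Two representatives differ by an element of \<open>N\<close>, which starts in degree 2.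
  Hence constant and linear coefficients do not depend on the representative.\<close>

lemma T_right_coeff_0: "T f g \<Longrightarrow> T f g' \<Longrightarrow> g 0 = g' 0"
  using T_right_unique[of f g g'] N_ge_2 by (auto dest!: subsetD simp: sk_ge_2_iff)

lemma T_right_coeff_1: "T f g \<Longrightarrow> T f g' \<Longrightarrow> i < m \<Longrightarrow> g (unit_exp i) = g' (unit_exp i)"
  using T_right_unique[of f g g'] N_ge_2 by (auto dest!: subsetD simp: sk_ge_2_iff)

text \<open>A relation between generators of the left ring, transported to arbitrary representatives
  of their images.\<close>

lemma T_swap_left:
  assumes "i < n" "j < n" "T (sk_var i) g" "T (sk_var j) h"
  shows "sk_mult p' m h g - (\<lambda>a. p i j * sk_mult p' m g h a) \<in> N"
proof -
  have "T (sk_mult p n (sk_var j) (sk_var i)) (sk_mult p' m h g)"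
    by (rule T_mult[OF assms(4,3)])
  moreover have "T (sk_mult p n (sk_var j) (sk_var i)) (\<lambda>a. p i j * sk_mult p' m g h a)"
    unfolding sk_var_swap[OF params assms(1,2)] by (rule T_scale[OF T_mult[OF assms(3,4)]])
  ultimately show ?thesis by (rule T_right_unique)
qed

text \<open>The augmentation ideals correspond to each other.\<close>
definition is_local :: bool where
  "is_local \<longleftrightarrow> (\<forall>i<n. \<forall>g. T (sk_var i) g \<longrightarrow> g 0 = 0)"

text \<open>Powers of the augmentation ideals correspond. Only some representative lies in
  \<open>sk_ge m d\<close>, since adding elements of \<open>N\<close> may create terms of lower
  degree.\<close>

lemma ge_image:
  assumes is_local "f \<in> sk_ge n d"
  shows "\<exists>g\<in>sk_ge m d. T f g"
  using assms(2)
proof (induction d arbitrary: f)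
  case 0
  then obtain g where "T f g" using left_total by (auto simp: sk_ge_0)
  then show ?case using T_right by (auto simp: sk_ge_0)
next
  case (Suc d)
  from Suc.prems params show ?case
  proof (induction rule: sk_ge_Suc_induct)
    case zero
    show ?case using T_0 zero_sk_ge by blast
  next
    case (add f g)
    then show ?case using T_add sk_ge_add by blast
  next
    case (mult i h)
    obtain g where g: "T (sk_var i) g" using left_total[OF sk_var_closed] mult(1) by blast
    then have "g \<in> sk_ge m 1"
      using assms(1) mult(1) T_right[OF g] unfolding is_local_def sk_ge_1_iff by blast
    moreover obtain h' where "h' \<in> sk_ge m d" "T h h'" using Suc.IH mult by blast
    ultimately show ?case using T_mult[OF g] sk_ge_mult[of g m 1 h' d p'] by auto
  qed
qed

text \<open>Subtracting the constant \<open>f 0\<close> on both sides leaves an element of the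
  augmentation ideal, whose image has no constant term.\<close>

lemma local_coeff_0:
  assumes is_local "T f g"
  shows "f 0 = g 0"
proof -
  have "f - sk_const (f 0) \<in> sk_ge n 1"
    unfolding sk_ge_1_iff using T_left[OF assms(2)]
    by (simp add: sk_carrier_diff) (simp add: sk_const_mono sk_mono_def)
  then obtain h where h: "h \<in> sk_ge m 1" "T (f - sk_const (f 0)) h"
    using ge_image[OF assms(1)] by blast
  have "T (f - sk_const (f 0)) (g - sk_const (f 0))" by (rule T_diff[OF assms(2) T_const])
  then have "(g - sk_const (f 0)) 0 = h 0" using h(2) by (rule T_right_coeff_0)
  then show ?thesis using h(1) unfolding sk_ge_1_iff by (simp add: sk_const_mono sk_mono_def)
qed

lemma local_swapped:
  assumes is_local shows "skew_corr.is_local m (\<lambda>g f. T f g)"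
  unfolding skew_corr.is_local_def[OF swapped]
proof (intro allI impI)
  fix i f assume "T f (sk_var i)"
  then have "f 0 = sk_var i 0" by (rule local_coeff_0[OF assms])
  then show "f 0 = 0" by (simp add: sk_var_mono sk_mono_def)
qed

text \<open>\<open>f\<close> minus its linear part has degree at least 2 and so has its image. The
  linear part of the image is therefore obtained by multiplying with the matrix of the linear parts
  of the \<open>G s\<close>.\<close>

lemma local_coeff_1:
  assumes is_local "T f g" "f 0 = 0" "\<And>s. s < n \<Longrightarrow> T (sk_var s) (G s)" "j < m"
  shows "g (unit_exp j) = (\<Sum>s<n. f (unit_exp s) * G s (unit_exp j))"
proof -
  let ?l = "\<Sum>s<n. (\<lambda>a. f (unit_exp s) * sk_var s a)"
  let ?r = "\<Sum>s<n. (\<lambda>a. f (unit_exp s) * G s a)"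
  have T: "T ?l ?r" using assms(4) by (intro T_sum T_scale) simp
  have "f - ?l \<in> sk_ge n 2"
    unfolding sk_ge_2_iff
  proof (intro conjI allI impI)
    show "f - ?l \<in> sk_carrier n" using T_left[OF assms(2)] T_left[OF T] by (rule sk_carrier_diff)
    show "(f - ?l) 0 = 0" using assms(3) by (simp add: sum_fun_apply sk_var_mono sk_mono_def)
    fix i assume "i < n"
    have "(\<Sum>s<n. f (unit_exp s) * sk_var s (unit_exp i)) = (\<Sum>s<n. if s = i then f (unit_exp i) else 0)"
      by (intro sum.cong) (auto simp: sk_var_mono sk_mono_def)
    then show "(f - ?l) (unit_exp i) = 0" using \<open>i < n\<close> by (simp add: sum_fun_apply sum.delta)
  qed
  then obtain h where h: "h \<in> sk_ge m 2" "T (f - ?l) h" using ge_image[OF assms(1)] by blast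
  have "(g - ?r) (unit_exp j) = h (unit_exp j)"
    by (rule T_right_coeff_1[OF T_diff[OF assms(2) T] h(2) assms(5)])
  also have "\<dots> = 0" using h(1) assms(5) by (simp add: sk_ge_2_iff)
  finally show ?thesis by (simp add: sum_fun_apply)
qed

section \<open>Isomorphisms that do not match the augmentation ideals\<close>

text \<open>If the images of the generators have linear parts on the line spanned by
  \<open>l\<close>, the Leibniz rule puts the linear part of every element on that line. The
  variables of the right ring are images as well, so its cotangent space at the origin is at most a
  line.\<close>

lemma linear_parts_dim:
  assumes "\<And>i g. i < n \<Longrightarrow> T (sk_var i) g \<Longrightarrow> \<exists>u. \<forall>j<m. g (unit_exp j) = u * l j"
  shows "m \<le> 1"
proof (rule ccontr)
  assume "\<not> m \<le> 1"
  then have m: "0 < m" "1 < m" by simp_all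
  have lin: "\<exists>g u. T f g \<and> (\<forall>j<m. g (unit_exp j) = u * l j)" if "f \<in> sk_carrier n" for f
    using that params
  proof (induction rule: sk_carrier_gen_induct)
    case (const c)
    have "\<forall>j<m. sk_const c (unit_exp j) = 0 * l j" by (simp add: sk_const_mono sk_mono_def)
    then show ?case using T_const by blast
  next
    case (add f f')
    then obtain g u g' u' where "T f g" "\<forall>j<m. g (unit_exp j) = u * l j"
      "T f' g'" "\<forall>j<m. g' (unit_exp j) = u' * l j" by blast
    then have "T (f + f') (g + g') \<and> (\<forall>j<m. (g + g') (unit_exp j) = (u + u') * l j)"
      by (simp add: T_add algebra_simps)
    then show ?case by blast
  next
    case (mult i h)
    then obtain g u where g: "T h g" "\<forall>j<m. g (unit_exp j) = u * l j" by blast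
    obtain x where x: "T (sk_var i) x" using left_total mult(1) sk_var_closed by blast
    then obtain v where v: "\<forall>j<m. x (unit_exp j) = v * l j" using assms mult(1) by blast
    have "sk_mult p' m x g (unit_exp j) = (x 0 * u + v * g 0) * l j" if "j < m" for j
      using that g(2) v T_right[OF x] by (simp add: sk_mult_coeff_1 algebra_simps)
    then show ?case using T_mult[OF x g(1)] by blast
  qed
  have "\<exists>u. \<forall>j<m. sk_var i (unit_exp j) = u * l j" if "i < m" for i
  proof -
    obtain f where f: "T f (sk_var i)" using right_total \<open>i < m\<close> sk_var_closed by blast
    then obtain g u where g: "T f g" "\<forall>j<m. g (unit_exp j) = u * l j" using lin T_left by blast
    then have "\<forall>j<m. sk_var i (unit_exp j) = u * l j" using T_right_coeff_1[OF f g(1)] by simp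
    then show ?thesis by blast
  qed
  then obtain u v where u: "\<forall>j<m. sk_var 0 (unit_exp j) = u * l j"
    and v: "\<forall>j<m. sk_var 1 (unit_exp j) = v * l j" using m by meson
  \<comment> \<open>Two different unit vectors cannot both be multiples of \<open>l\<close>.\<close>
  have "u * l 0 = 1" "u * l 1 = 0" "v * l 1 = 1"
    using u[rule_format, OF m(1)] u[rule_format, OF m(2)] v[rule_format, OF m(2)]
    by (simp_all add: sk_var_mono sk_mono_def)
  then have "u \<noteq> 0" "l 1 = 0" by (metis mult_zero_left zero_neq_one, metis mult_eq_0_iff mult_zero_left zero_neq_one)
  then show False using \<open>v * l 1 = 1\<close> by simp
qed

text \<open>The line is spanned by the linear part of \<open>h\<close>. For i different from s, the
  relation x_i x_s = p_si x_s x_i, read in degree 0 and then in degree 1, kills the constant and the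
  linear part of \<open>g\<close>, because p_si is not 1 and \<open>h 0\<close> is not 0.\<close>

lemma nonlocal_dim:
  assumes not1: "\<And>i j. i < n \<Longrightarrow> j < n \<Longrightarrow> i \<noteq> j \<Longrightarrow> p i j \<noteq> 1"
    and s: "s < n" "T (sk_var s) h" "h 0 \<noteq> 0"
  shows "m \<le> 1"
proof (rule linear_parts_dim)
  fix i g assume i: "i < n" "T (sk_var i) g"
  show "\<exists>u. \<forall>j<m. g (unit_exp j) = u * h (unit_exp j)"
  proof (cases "i = s")
    case True
    then have "\<forall>j<m. g (unit_exp j) = 1 * h (unit_exp j)"
      using T_right_coeff_1[OF i(2)] s by simp
    then show ?thesis by blast
  next
    case False
    have q: "p s i \<noteq> 1" using not1 s(1) i(1) False by simp
    have c: "g \<in> sk_carrier m" "h \<in> sk_carrier m" using T_right i s by blast+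
    have ge: "sk_mult p' m g h - (\<lambda>a. p s i * sk_mult p' m h g a) \<in> sk_ge m 2"
      using T_swap_left[OF s(1) i(1) s(2) i(2)] N_ge_2 by blast
    then have "g 0 * h 0 - p s i * (h 0 * g 0) = 0"
      using c by (simp add: sk_ge_2_iff sk_mult_coeff_0)
    then have "(1 - p s i) * (g 0 * h 0) = 0" by (simp add: left_diff_distrib mult.commute)
    then have g0: "g 0 = 0" using q s(3) by simp
    have "g (unit_exp j) = 0" if "j < m" for j
    proof -
      have "g (unit_exp j) * h 0 - p s i * (h 0 * g (unit_exp j)) = 0"
        using ge c g0 that by (simp add: sk_ge_2_iff sk_mult_coeff_1)
      then have "(1 - p s i) * (g (unit_exp j) * h 0) = 0" by (simp add: left_diff_distrib mult.commute)
      then show ?thesis using q s(3) by simp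
    qed
    then have "\<forall>j<m. g (unit_exp j) = 0 * h (unit_exp j)" by simp
    then show ?thesis by blast
  qed
qed

text \<open>With one generator the line is given by the linear part of its image. This brings m = 1
  back to n = 1 through the swapped correspondence, where nothing is known about \<open>p'\<close>
  being distinct from 1.\<close>

lemma dim_le_1:
  assumes "n = 1" shows "m \<le> 1"
proof -
  obtain h where h: "T (sk_var 0) h" using left_total[of "sk_var 0"] assms by auto
  show ?thesis
  proof (rule linear_parts_dim)
    fix i g assume i: "i < n" "T (sk_var i) g"
    then have "i = 0" using assms by simp
    then have "\<forall>j<m. g (unit_exp j) = 1 * h (unit_exp j)"
      using T_right_coeff_1[OF i(2)] h by simp
    then show "\<exists>u. \<forall>j<m. g (unit_exp j) = u * h (unit_exp j)" by blast
  qed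
qed

text \<open>The constant term of the image is multiplicative and nonzero on x_0, hence nonzero on
  every nonzero monomial; so no such monomial lies in \<open>M\<close>. A nonzero graded ideal in
  one variable would contain one.\<close>

lemma nonlocal_ideal:
  assumes "n = 1" "T (sk_var 0) g" "g 0 \<noteq> 0"
  shows "M = {0}"
proof -
  have mono: "\<exists>h. T (sk_mono a u) h \<and> h 0 \<noteq> 0" if "a \<in> exps n" "mdeg n a = d" "u \<noteq> 0" for a u d
    using that
  proof (induction d arbitrary: a u)
    case 0
    then have "a = 0" by (simp only: mdeg_eq_0)
    then have "T (sk_mono a u) (sk_const u) \<and> sk_const u 0 \<noteq> 0"
      using T_const[of u] 0 by (simp add: sk_const_mono) (simp add: sk_mono_def)
    then show ?case by blast
  next
    case (Suc d)
    have i: "0 < n" "0 < a 0" using Suc.prems assms(1) by (auto simp: mdeg_def)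
    then have "mdeg n (a - unit_exp 0) = d"
      using Suc.prems mdeg_diff[of "unit_exp 0" a n] by (simp add: unit_exp_le_iff)
    moreover have "u / sk_twist p n (unit_exp 0) (a - unit_exp 0) \<noteq> 0"
      using Suc.prems(3) sk_twist_nonzero[OF params] by simp
    ultimately obtain h where h: "T (sk_mono (a - unit_exp 0) (u / sk_twist p n (unit_exp 0) (a - unit_exp 0))) h" "h 0 \<noteq> 0"
      using Suc.IH[OF exps_minus[OF Suc.prems(1)]] by blast
    have "T (sk_mono a u) (sk_mult p' m g h)"
      unfolding sk_mono_factor[of n p 0 a u, OF params i] by (rule T_mult[OF assms(2) h(1)])
    moreover have "sk_mult p' m g h 0 \<noteq> 0"
      using T_right[OF assms(2)] assms(3) h(2) by (simp add: sk_mult_coeff_0)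
    ultimately show ?case by blast
  qed
  have "f = 0" if f: "f \<in> M" for f
  proof (rule ccontr)
    assume "f \<noteq> 0"
    then obtain a where a: "f a \<noteq> 0" by (auto simp: fun_eq_iff)
    have exps: "a \<in> exps n" if "f a \<noteq> 0" for a
      using that sk_carrier_eq_0[OF sk_ideal_carrier[OF graded_M f]] by blast
    \<comment> \<open>With a single variable the degree determines the exponent, so a homogeneous
      component is one monomial.\<close>
    have "b = a" if "mdeg n b = mdeg n a" "f b \<noteq> 0" for b
    proof
      fix i show "b i = a i"
        using exps[OF a] exps[OF that(2)] that(1) assms(1) by (cases i) (auto simp: mdeg_def exps_def)
    qed
    then have "hom_comp n (mdeg n a) f = sk_mono a (f a)"
      by (intro ext) (auto simp only: hom_comp_def sk_mono_def split: if_split)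
    then have "T (sk_mono a (f a)) 0"
      using sk_ideal_hom_comp[OF graded_M f, of "mdeg n a"] by (simp add: T_0_right)
    moreover obtain h where "T (sk_mono a (f a)) h" "h 0 \<noteq> 0" using mono[OF exps[OF a] refl a] by blast
    ultimately show False using T_right_coeff_0 by fastforce
  qed
  then show ?thesis using sk_ideal_zero[OF graded_M] by blast
qed

lemma nonlocal:
  assumes not1: "\<And>i j. i < n \<Longrightarrow> j < n \<Longrightarrow> i \<noteq> j \<Longrightarrow> p i j \<noteq> 1"
    and "m \<ge> 1" and nl: "\<not> is_local"
  shows "n = 1 \<and> m = 1 \<and> M = {0} \<and> N = {0}"
proof -
  interpret sw: skew_corr p' m N p n M "\<lambda>g f. T f g" by (rule swapped)
  obtain s h where s: "s < n" "T (sk_var s) h" "h 0 \<noteq> 0" using nl by (auto simp: is_local_def)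
  have m: "m = 1" using nonlocal_dim[OF not1 s] \<open>m \<ge> 1\<close> by simp
  have n: "n = 1" using sw.dim_le_1[OF m] s(1) by simp
  have "M = {0}" using nonlocal_ideal[OF n] s n by simp
  \<comment> \<open>If the mirrored correspondence were local, swapping once more would make the
    original one local.\<close>
  moreover have "\<not> sw.is_local" using sw.local_swapped nl by blast
  then obtain i f where "i < m" "T f (sk_var i)" "f 0 \<noteq> 0" unfolding sw.is_local_def by blast
  then have "N = {0}" using sw.nonlocal_ideal[OF m] m by simp
  ultimately show ?thesis using n m by blast
qed

end

section \<open>The local case\<close>

text \<open>By \<open>cols\<close> each column of \<open>K\<close> has at most one nonzero entry,
  and by invertibility each row and column has at least one. Rows having only one, as well as the
  equality of the two sizes, come from the left inverse.\<close>

lemma monomial_matrix: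
  fixes K L :: "nat \<Rightarrow> nat \<Rightarrow> 'k::field"
  assumes KL: "\<And>i. i < m \<Longrightarrow> (\<Sum>s<n. K i s * L s i) = 1"
    and LK: "\<And>s t. s < n \<Longrightarrow> t < n \<Longrightarrow> (\<Sum>i<m. L s i * K i t) = (if s = t then 1 else 0)"
    and cols: "\<And>i j s. i < m \<Longrightarrow> j < m \<Longrightarrow> i \<noteq> j \<Longrightarrow> s < n \<Longrightarrow> K i s * K j s = 0"
  obtains \<sigma> where "n = m" "\<sigma> permutes {..<n}" "\<And>i. i < n \<Longrightarrow> K i (\<sigma> i) \<noteq> 0"
    "\<And>i s. i < n \<Longrightarrow> s < n \<Longrightarrow> s \<noteq> \<sigma> i \<Longrightarrow> K i s = 0"
proof -
  have "\<exists>s<n. K i s \<noteq> 0" if "i < m" for i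
  proof (rule ccontr)
    assume "\<not> ?thesis"
    then have "(\<Sum>s<n. K i s * L s i) = 0" by (intro sum.neutral) auto
    then show False using KL[OF that] by simp
  qed
  then obtain \<rho> where \<rho>: "\<And>i. i < m \<Longrightarrow> \<rho> i < n" "\<And>i. i < m \<Longrightarrow> K i (\<rho> i) \<noteq> 0" by metis
  have row: "t = s" if *: "i < m" "s < n" "t < n" "K i s \<noteq> 0" "K i t \<noteq> 0" for i s t
  proof (rule ccontr)
    assume "t \<noteq> s"
    \<comment> \<open>A column with a nonzero entry in row i vanishes elsewhere, so this entry of
      the product L K is a single term. Taking r = s and r = t gives 1 and 0, which is incompatible
      with both entries of row i being nonzero.\<close>
    have "(\<Sum>j<m. L s j * K j r) = L s i * K i r" if "r < n" "K i r \<noteq> 0" for r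
    proof -
      have "K j r = 0" if "j < m" "j \<noteq> i" for j
        using cols[OF that(1) *(1) that(2) \<open>r < n\<close>] \<open>K i r \<noteq> 0\<close> by simp
      then have "(\<Sum>j<m. L s j * K j r) = (\<Sum>j<m. if j = i then L s i * K i r else 0)"
        by (intro sum.cong) auto
      then show ?thesis using *(1) by (simp add: sum.delta)
    qed
    then have "L s i * K i s = 1" "L s i * K i t = 0"
      using LK[of s s] LK[of s t] * \<open>t \<noteq> s\<close> by auto
    then show False using *(5) by simp
  qed
  have inj: "inj_on \<rho> {..<m}"
  proof (rule inj_onI)
    fix i j assume ij: "i \<in> {..<m}" "j \<in> {..<m}" "\<rho> i = \<rho> j"
    show "i = j"
    proof (rule ccontr)
      assume "i \<noteq> j"
      then have "K i (\<rho> i) * K j (\<rho> i) = 0" using cols[of i j "\<rho> i"] ij \<rho>(1) by auto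
      then show False using \<rho>(2)[of i] \<rho>(2)[of j] ij by auto
    qed
  qed
  have "\<rho> ` {..<m} = {..<n}"
  proof
    show "\<rho> ` {..<m} \<subseteq> {..<n}" using \<rho>(1) by auto
    show "{..<n} \<subseteq> \<rho> ` {..<m}"
    proof
      fix s assume "s \<in> {..<n}"
      then have s: "s < n" by simp
      have "\<exists>i<m. K i s \<noteq> 0"
      proof (rule ccontr)
        assume "\<not> ?thesis"
        then have "(\<Sum>i<m. L s i * K i s) = 0" by (intro sum.neutral) auto
        then show False using LK[OF s s] by simp
      qed
      then obtain i where "i < m" "K i s \<noteq> 0" by blast
      then have "s = \<rho> i" using row[of i "\<rho> i" s] \<rho> s by blast
      then show "s \<in> \<rho> ` {..<m}" using \<open>i < m\<close> by blast
    qed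
  qed
  then have bij: "bij_betw \<rho> {..<m} {..<n}" using inj by (simp add: bij_betw_def)
  then have nm: "n = m" using bij_betw_same_card by fastforce
  \<comment> \<open>\<open>permutes\<close> demands the identity outside \<open>{..<n}\<close>,
    where nothing is known about \<open>\<rho>\<close>.\<close>
  define \<sigma> where "\<sigma> i = (if i < n then \<rho> i else i)" for i
  have "bij_betw \<sigma> {..<n} {..<n} \<longleftrightarrow> bij_betw \<rho> {..<n} {..<n}"
    by (rule bij_betw_cong) (simp add: \<sigma>_def)
  then have "bij_betw \<sigma> {..<n} {..<n}" using bij nm by simp
  then have "\<sigma> permutes {..<n}" by (rule bij_imp_permutes) (simp add: \<sigma>_def)
  moreover have "K i (\<sigma> i) \<noteq> 0" if "i < n" for i using that \<rho>(2) nm by (simp add: \<sigma>_def)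
  moreover have "K i s = 0" if "i < n" "s < n" "s \<noteq> \<sigma> i" for i s
    using row[of i "\<rho> i" s] \<rho>[of i] that nm by (auto simp: \<sigma>_def)
  ultimately show ?thesis using that nm by blast
qed

context skew_corr
begin

text \<open>\<open>F i\<close> lifts the generator x_i of B to A, and the scalars \<open>c\<close>
  are the nonzero entries of the matrix \<open>K\<close> of linear parts of these lifts. The lifts
  are returned too, because \<open>local_image\<close> compares them with the substitution.\<close>

lemma local_case:
  assumes loc: is_local and M3: "M \<subseteq> sk_ge n 3"
    and not1: "\<And>i j. i < n \<Longrightarrow> j < n \<Longrightarrow> i \<noteq> j \<Longrightarrow> p i j \<noteq> 1"
  obtains \<sigma> c F where "n = m" "monomial_subst p p' n \<sigma> c"
    "\<And>i. i < m \<Longrightarrow> T (F i) (sk_var i)"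
    "\<And>i. i < m \<Longrightarrow> F i - (\<lambda>a. c i * sk_var (\<sigma> i) a) \<in> sk_ge n 2"
proof -
  interpret sw: skew_corr p' m N p n M "\<lambda>g f. T f g" by (rule swapped)
  have sloc: "sw.is_local" by (rule local_swapped[OF loc])
  obtain F where F: "\<And>i. i < m \<Longrightarrow> T (F i) (sk_var i)"
    using right_total[OF sk_var_closed] by metis
  obtain G where G: "\<And>s. s < n \<Longrightarrow> T (sk_var s) (G s)"
    using left_total[OF sk_var_closed] by metis
  have F0: "F i 0 = 0" if "i < m" for i
    using sloc F[OF that] that by (auto simp: sw.is_local_def)
  have G0: "G s 0 = 0" if "s < n" for s
    using loc G[OF that] that by (auto simp: is_local_def)
  have F1: "F i \<in> sk_ge n 1" if "i < m" for i
    unfolding sk_ge_1_iff using F0[OF that] T_left[OF F[OF that]] by blast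
  define K where "K i s = F i (unit_exp s)" for i s
  define L where "L s i = G s (unit_exp i)" for s i
  have var_coeff: "sk_var i (unit_exp j) = (if i = j then 1 else 0 :: 'k)" for i j
    by (auto simp: sk_var_mono sk_mono_def)
  have KL: "(\<Sum>s<n. K i s * L s j) = (if i = j then 1 else 0)" if "i < m" "j < m" for i j
    using local_coeff_1[OF loc F[OF that(1)] F0[OF that(1)] G that(2)]
    by (simp add: K_def L_def var_coeff)
  have LK: "(\<Sum>i<m. L s i * K i t) = (if s = t then 1 else 0)" if "s < n" "t < n" for s t
    using sw.local_coeff_1[OF sloc G[OF that(1)] G0[OF that(1)] F that(2)]
    by (simp add: K_def L_def var_coeff)
  \<comment> \<open>A relation of B holds for the lifts modulo \<open>M\<close>, hence exactly in
    degree 2.\<close>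
  have rel: "sk_mult p n (F j) (F i) (unit_exp s + unit_exp t) =
      p' i j * sk_mult p n (F i) (F j) (unit_exp s + unit_exp t)"
    if "i < m" "j < m" "s < n" "t < n" for i j s t
  proof -
    have "sk_mult p n (F j) (F i) - (\<lambda>a. p' i j * sk_mult p n (F i) (F j) a) \<in> sk_ge n 3"
      using sw.T_swap_left[OF that(1,2) F[OF that(1)] F[OF that(2)]] M3 by blast
    then have "(sk_mult p n (F j) (F i) - (\<lambda>a. p' i j * sk_mult p n (F i) (F j) a)) (unit_exp s + unit_exp t) = 0"
      by (rule sk_ge_coeff) (simp add: mdeg_add that)
    then show ?thesis by simp
  qed
  have rel_diag: "K j s * K i s = p' i j * (K i s * K j s)" if "i < m" "j < m" "s < n" for i j s
    using rel[OF that that(3)] F1 that by (simp add: sk_mult_coeff_2 K_def)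
  have rel_off: "swap_factor p s t * K j s * K i t + swap_factor p t s * K j t * K i s =
      p' i j * (swap_factor p s t * K i s * K j t + swap_factor p t s * K i t * K j s)"
    if "i < m" "j < m" "s < n" "t < n" "s \<noteq> t" for i j s t
    using rel[OF that(1-4)] F1 that by (simp add: sk_mult_coeff_2 K_def)
  \<comment> \<open>otherwise all 2 by 2 minors of rows i and j of K vanish, although K has a right inverse\<close>
  have p'_not1: "p' i j \<noteq> 1" if ij: "i < m" "j < m" "i \<noteq> j" for i j
  proof
    assume one: "p' i j = 1"
    have minor: "K j s * K i t = K i s * K j t" if st: "s < n" "t < n" for s t
    proof (cases "s = t")
      case False
      \<comment> \<open>The ratio of the two factors is p_st, which is not 1; with p'_ij = 1 the
        relation is their difference times the minor.\<close>
      have "swap_factor p t s \<noteq> swap_factor p s t"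
        using swap_factor_swap[OF params st] not1[OF st False] skew_params_nonzero[OF params st(2,1)]
          not1[OF st(2,1)] False
        by (auto simp: swap_factor_def)
      moreover have "(swap_factor p s t - swap_factor p t s) * (K j s * K i t - K i s * K j t) = 0"
        using rel_off[OF ij(1,2) st False] one by (simp add: algebra_simps)
      ultimately show ?thesis by simp
    qed (simp add: mult.commute)
    \<comment> \<open>Vanishing minors give (KL)_jj (KL)_ii = (KL)_ij (KL)_ji, that is 1 =
      0.\<close>
    have "(\<Sum>s<n. K j s * L s j) * (\<Sum>t<n. K i t * L t i) =
        (\<Sum>s<n. \<Sum>t<n. (K j s * K i t) * (L s j * L t i))"
      unfolding sum_product by (intro sum.cong) (simp_all add: mult_ac)
    also have "\<dots> = (\<Sum>s<n. \<Sum>t<n. (K i s * K j t) * (L s j * L t i))"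
      by (intro sum.cong) (simp_all add: minor)
    also have "\<dots> = (\<Sum>s<n. K i s * L s j) * (\<Sum>t<n. K j t * L t i)"
      unfolding sum_product by (intro sum.cong) (simp_all add: mult_ac)
    finally show False using KL ij by simp
  qed
  have cols: "K i s * K j s = 0" if ij: "i < m" "j < m" "i \<noteq> j" and "s < n" for i j s
  proof -
    \<comment> \<open>This is the coefficient of x_s^2 in the relation.\<close>
    have "(1 - p' i j) * (K i s * K j s) = 0"
      using rel_diag[OF ij(1,2) \<open>s < n\<close>] by (simp add: algebra_simps)
    then show ?thesis using p'_not1[OF ij] by simp
  qed
  have KL1: "(\<Sum>s<n. K i s * L s i) = 1" if "i < m" for i using KL[OF that that] by simp
  obtain \<sigma> where \<sigma>: "n = m" "\<sigma> permutes {..<n}" "\<And>i. i < n \<Longrightarrow> K i (\<sigma> i) \<noteq> 0"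
      "\<And>i s. i < n \<Longrightarrow> s < n \<Longrightarrow> s \<noteq> \<sigma> i \<Longrightarrow> K i s = 0"
    by (rule monomial_matrix[where m = m and n = n and K = K and L = L, OF KL1 LK cols]; (assumption | rule that))
  have \<sigma>n: "\<sigma> i < n" if "i < n" for i using permutes_in_image[OF \<sigma>(2), of i] that by simp
  have "monomial_subst p p' n \<sigma> (\<lambda>i. K i (\<sigma> i))"
  proof
    show "skew_params n p" "skew_params n p'" "\<sigma> permutes {..<n}" "\<And>i. i < n \<Longrightarrow> K i (\<sigma> i) \<noteq> 0"
      using params params' \<sigma> by simp_all
    fix i j assume ij: "i < n" "j < n"
    show "p' i j = p (\<sigma> i) (\<sigma> j)"
    proof (cases "i = j")
      case True
      then show ?thesis
        using skew_params_self[OF params \<sigma>n[OF ij(1)]] skew_params_self[OF params', of i] ij \<sigma>(1) by simp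
    next
      case False
      let ?s = "\<sigma> i" and ?t = "\<sigma> j"
      have st: "?s < n" "?t < n" "?s \<noteq> ?t"
        using \<sigma>n ij False permutes_inj[OF \<sigma>(2)] by (auto dest: injD)
      \<comment> \<open>In the coefficient of x_(\<sigma> i) x_(\<sigma> j) only the two nonzero
        entries of K survive, so the relation equates p'_ij with the ratio of the two reordering
        factors.\<close>
      have "K j ?s = 0" "K i ?t = 0" using \<sigma>(4) ij st by auto
      then have "swap_factor p ?t ?s * (K j ?t * K i ?s) = p' i j * swap_factor p ?s ?t * (K j ?t * K i ?s)"
        using rel_off[of i j ?s ?t] ij st \<sigma>(1) by (simp add: mult_ac)
      then have "swap_factor p ?t ?s = p' i j * swap_factor p ?s ?t"
        using \<sigma>(3)[OF ij(1)] \<sigma>(3)[OF ij(2)] by simp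
      then have "p ?s ?t * swap_factor p ?s ?t = p' i j * swap_factor p ?s ?t"
        using swap_factor_swap[OF params st(1,2)] by simp
      moreover have "swap_factor p ?s ?t \<noteq> 0"
        using skew_params_nonzero[OF params st(2,1)] by (simp add: swap_factor_def)
      ultimately show ?thesis by simp
    qed
  qed
  moreover have "F i - (\<lambda>a. K i (\<sigma> i) * sk_var (\<sigma> i) a) \<in> sk_ge n 2" if "i < m" for i
    unfolding sk_ge_2_iff
  proof (intro conjI allI impI)
    have i: "i < n" using that \<sigma>(1) by simp
    show "F i - (\<lambda>a. K i (\<sigma> i) * sk_var (\<sigma> i) a) \<in> sk_carrier n"
      using T_left[OF F[OF that]] \<sigma>n[OF i] by (simp add: sk_carrier_diff sk_carrier_scale)
    show "(F i - (\<lambda>a. K i (\<sigma> i) * sk_var (\<sigma> i) a)) 0 = 0"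
      using F0[OF that] by (simp add: sk_var_mono sk_mono_def)
    fix s assume "s < n"
    then show "(F i - (\<lambda>a. K i (\<sigma> i) * sk_var (\<sigma> i) a)) (unit_exp s) = 0"
      using \<sigma>(4)[OF i, of s] by (auto simp: var_coeff K_def)
  qed
  ultimately show ?thesis using that[of \<sigma> "\<lambda>i. K i (\<sigma> i)" F] \<sigma>(1) F by blast
qed

text \<open>Both ideals are graded, so homogeneous components suffice. On these the isomorphism and
  \<open>\<Phi>\<close> agree up to higher degree, and taking the component of lowest degree removes
  the error.\<close>

lemma local_image:
  assumes loc: is_local and nm: "n = m" and subst: "monomial_subst p p' n \<sigma> c"
    and F: "\<And>i. i < m \<Longrightarrow> T (F i) (sk_var i)"
    and F_approx: "\<And>i. i < m \<Longrightarrow> F i - (\<lambda>a. c i * sk_var (\<sigma> i) a) \<in> sk_ge n 2"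
  shows "sk_subst p n n (\<lambda>i a. c i * sk_var (\<sigma> i) a) ` N = M"
proof -
  interpret monomial_subst p p' n \<sigma> c by (rule subst)
  \<comment> \<open>the isomorphism agrees with \<open>\<Phi>\<close> on lowest-degree terms\<close>
  have approx: "\<exists>f\<in>sk_ge n d. T f g \<and> f - \<Phi> g \<in> sk_ge n (Suc d)" if "g \<in> sk_ge n d" for g d
    using that
  proof (induction d arbitrary: g)
    case 0
    then have g: "g \<in> sk_carrier n" by (simp add: sk_ge_0)
    then obtain f where f: "T f g" using right_total nm by blast
    \<comment> \<open>\<open>\<Phi>\<close> fixes constants and preserves the augmentation ideal, so
      it keeps constant terms, as does the correspondence.\<close>
    have "g 0 = \<Phi> g 0"
    proof -
      have "g - sk_const (g 0) \<in> sk_ge n 1" unfolding sk_ge_1_iff using g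
        by (simp add: sk_carrier_diff) (simp add: sk_const_mono sk_mono_def)
      then have "\<Phi> (g - sk_const (g 0)) 0 = 0" using \<Phi>_ge sk_ge_1_iff by blast
      moreover have "\<Phi> g = \<Phi> (g - sk_const (g 0)) + sk_const (g 0)"
        using \<Phi>_add[of "g - sk_const (g 0)" "sk_const (g 0)"] g by (simp add: sk_carrier_diff \<Phi>_const)
      ultimately show ?thesis by (simp add: sk_const_mono sk_mono_def)
    qed
    then have "f - \<Phi> g \<in> sk_ge n (Suc 0)"
      using sk_ge_1_iff[of "f - \<Phi> g" n] local_coeff_0[OF loc f] T_left[OF f] \<Phi>_carrier[OF g]
      by (simp add: sk_carrier_diff)
    then show ?case using f T_left[OF f] unfolding sk_ge_0 by blast
  next
    case (Suc d)
    from Suc.prems params' show ?case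
      unfolding nm[symmetric]
    proof (induction rule: sk_ge_Suc_induct)
      case zero
      have "\<Phi> 0 = 0" using \<Phi>_const[of 0] by (simp only: sk_const_0)
      then have "0 - \<Phi> 0 \<in> sk_ge n (Suc (Suc d))" by (simp only: diff_zero zero_sk_ge)
      then show ?case using T_0 zero_sk_ge by blast
    next
      case (add g g')
      then obtain f f' where f: "f \<in> sk_ge n (Suc d)" "T f g" "f - \<Phi> g \<in> sk_ge n (Suc (Suc d))"
        and f': "f' \<in> sk_ge n (Suc d)" "T f' g'" "f' - \<Phi> g' \<in> sk_ge n (Suc (Suc d))" by blast
      have "\<Phi> (g + g') = \<Phi> g + \<Phi> g'"
        by (rule \<Phi>_add[OF T_right[OF f(2), folded nm] T_right[OF f'(2), folded nm]])
      then have "f + f' - \<Phi> (g + g') = (f - \<Phi> g) + (f' - \<Phi> g')" by simp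
      then have "f + f' - \<Phi> (g + g') \<in> sk_ge n (Suc (Suc d))"
        using sk_ge_add[OF f(3) f'(3)] by (simp only:)
      then show ?case using T_add[OF f(2) f'(2)] sk_ge_add[OF f(1) f'(1)] by blast
    next
      case (mult i h)
      let ?l = "\<lambda>a. c i * sk_var (\<sigma> i) a"
      have i: "i < m" using mult nm by simp
      have l: "?l \<in> sk_ge n 1" using mult(1) by (intro sk_ge_scale sk_var_ge sigma_less)
      have h: "h \<in> sk_carrier n" by (rule sk_ge_carrier[OF mult(2)])
      obtain f where f: "f \<in> sk_ge n d" "T f h" "f - \<Phi> h \<in> sk_ge n (Suc d)"
        using Suc.IH[OF mult(2)] by blast
      have Fi: "F i \<in> sk_ge n 1"
      proof -
        have "F i = (F i - ?l) + ?l" by simp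
        moreover have "F i - ?l \<in> sk_ge n 1" using F_approx[OF i] by (rule sk_ge_antimono) simp
        ultimately show ?thesis using l sk_ge_add by metis
      qed
      have "\<Phi> (sk_mult p' n (sk_var i) h) = sk_mult p n ?l (\<Phi> h)"
        using mult(1) h by (simp add: \<Phi>_mult \<Phi>_var)
      \<comment> \<open>Replace \<open>F i\<close> by its linear part, then \<open>f\<close> by
        \<open>\<Phi> h\<close>; each replacement gains one degree over the degree d + 1 of the
        product.\<close>
      moreover have "sk_mult p n (F i) f - sk_mult p n ?l (\<Phi> h) =
          sk_mult p n (F i - ?l) f + sk_mult p n ?l (f - \<Phi> h)"
        using sk_ge_carrier[OF Fi] sk_ge_carrier[OF f(1)] sk_ge_carrier[OF l] \<Phi>_carrier[OF h]
        by (simp add: sk_mult_diff_left sk_mult_diff_right)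
      moreover have "sk_mult p n (F i - ?l) f + sk_mult p n ?l (f - \<Phi> h) \<in> sk_ge n (Suc (Suc d))"
        using sk_ge_mult[OF F_approx[OF i] f(1), of p] sk_ge_mult[OF l f(3), of p]
        by (intro sk_ge_add) simp_all
      ultimately have "sk_mult p n (F i) f - \<Phi> (sk_mult p' n (sk_var i) h) \<in> sk_ge n (Suc (Suc d))"
        by (simp only:)
      moreover have "sk_mult p n (F i) f \<in> sk_ge n (Suc d)" using sk_ge_mult[OF Fi f(1), of p] by simp
      moreover have "T (sk_mult p n (F i) f) (sk_mult p' n (sk_var i) h)"
        using T_mult[OF F[OF i] f(2)] nm by simp
      ultimately show ?case by blast
    qed
  qed
  have hom_ge: "hom_comp n d f \<in> sk_ge n d" if "hom_comp n d f \<in> sk_carrier n" for f :: "'k skpoly" and d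
    using that by (auto simp: sk_ge_def hom_comp_def split: if_splits)
  have hom_cong: "hom_comp n d f = hom_comp n d f'" if "f - f' \<in> sk_ge n (Suc d)" for d and f f' :: "'k skpoly"
  proof
    fix a
    show "hom_comp n d f a = hom_comp n d f' a"
      using sk_ge_coeff[OF that, of a] by (simp add: hom_comp_def)
  qed
  have hom_hom: "hom_comp n d (hom_comp n d f) = hom_comp n d f" for d and f :: "'k skpoly"
    by (auto simp: hom_comp_def)
  show ?thesis
  proof
    show "\<Phi> ` N \<subseteq> M"
    proof
      fix x assume "x \<in> \<Phi> ` N"
      then obtain g where g: "g \<in> N" "x = \<Phi> g" by blast
      have gc: "g \<in> sk_carrier n" using sk_ideal_carrier[OF graded_N g(1)] nm by simp
      have "hom_comp n d (\<Phi> g) \<in> M" for d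
      proof -
        have gd: "hom_comp n d g \<in> N" using sk_ideal_hom_comp[OF graded_N g(1)] nm by simp
        then have gdc: "hom_comp n d g \<in> sk_carrier n" using sk_ideal_carrier[OF graded_N] nm by simp
        obtain f where f: "T f (hom_comp n d g)" "f - \<Phi> (hom_comp n d g) \<in> sk_ge n (Suc d)"
          using approx[OF hom_ge[OF gdc]] by blast
        have "T 0 (hom_comp n d g)" using gd by (simp add: T_0_left)
        \<comment> \<open>The component of \<open>g\<close> lies in \<open>N\<close>, so it
          corresponds to 0 as well as to \<open>f\<close>; subtracting puts \<open>f\<close> into
          \<open>M\<close>.\<close>
        then have "T (f - 0) (hom_comp n d g - hom_comp n d g)" using f(1) by (rule T_diff[rotated])
        then have "f \<in> M" by (simp add: T_0_right)
        then have "hom_comp n d f \<in> M" by (rule sk_ideal_hom_comp[OF graded_M])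
        then show ?thesis using hom_cong[OF f(2)] \<Phi>_hom_comp[OF gc gdc] by (simp add: hom_hom)
      qed
      then show "x \<in> M" using sk_ideal_memI[OF graded_M \<Phi>_carrier[OF gc]] g(2) by simp
    qed
    show "M \<subseteq> \<Phi> ` N"
    proof
      fix f assume f: "f \<in> M"
      have "f \<in> sk_ge n 0" using sk_ideal_carrier[OF graded_M f] by (simp add: sk_ge_0)
      then obtain g where g: "g \<in> sk_carrier n" "\<Phi> g = f" by (rule \<Phi>_surj_ge) (simp add: sk_ge_0)
      have "hom_comp n d g \<in> N" for d
      proof -
        have fd: "hom_comp n d f \<in> M" by (rule sk_ideal_hom_comp[OF graded_M f])
        have "{a. hom_comp n d g a \<noteq> 0} \<subseteq> {a. g a \<noteq> 0}" by (auto simp: hom_comp_def)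
        then have gdc: "hom_comp n d g \<in> sk_carrier n"
          using g(1) unfolding sk_carrier_iff by (meson finite_subset order_trans)
        then have eq: "\<Phi> (hom_comp n d g) = hom_comp n d f" using \<Phi>_hom_comp[OF g(1)] g(2) by simp
        obtain x where x: "T x (hom_comp n d g)" "x - hom_comp n d f \<in> sk_ge n (Suc d)"
          using approx[OF hom_ge[OF gdc]] eq by auto
        have "T (hom_comp n d f) 0" using fd by (simp add: T_0_right)
        \<comment> \<open>Subtracting an element of \<open>M\<close> does not change the class of
          \<open>x\<close>, but it raises the degree above d. A representative \<open>y\<close> of
          degree above d therefore exists, and \<open>hom_comp n d g\<close> is the degree-d
          component of an element of \<open>N\<close>.\<close>
        then have T: "T (x - hom_comp n d f) (hom_comp n d g)" using T_diff[OF x(1)] by fastforce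
        obtain y where y: "y \<in> sk_ge m (Suc d)" "T (x - hom_comp n d f) y"
          using ge_image[OF loc x(2)] by blast
        have "hom_comp n d g - y \<in> N" by (rule T_right_unique[OF T y(2)])
        then have "hom_comp n d (hom_comp n d g - y) \<in> N"
          using sk_ideal_hom_comp[OF graded_N] nm by simp
        moreover have "hom_comp n d (hom_comp n d g - y) = hom_comp n d g"
        proof -
          have "hom_comp n d (hom_comp n d g - y) = hom_comp n d (hom_comp n d g)"
            using sk_ge_uminus[OF y(1)] nm by (intro hom_cong) simp
          then show ?thesis by (simp only: hom_hom)
        qed
        ultimately show ?thesis by simp
      qed
      then have "g \<in> N" using sk_ideal_memI[OF graded_N] g(1) nm by simp
      then show "f \<in> \<Phi> ` N" using g(2) by blast
    qed
  qed
qed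

end

section \<open>From an isomorphism of quotients to a correspondence\<close>

text \<open>Totality on the right comes from surjectivity of \<open>\<phi>\<close>, and the
  description of the elements related to 0 from the kernels of the two quotient maps together with
  injectivity.\<close>

lemma skew_corr_of_iso:
  assumes "skew_params n p" "skew_params m p'" "graded_ideal p n M" "graded_ideal p' m N"
    and "M \<subseteq> sk_ge n 2" "N \<subseteq> sk_ge m 2" and iso: "alg_iso_quot p n M p' m N \<phi>"
  shows "skew_corr p n M p' m N (\<lambda>f g. f \<in> sk_carrier n \<and> g \<in> sk_carrier m \<and>
    \<phi> (M +>\<^bsub>skew_ring p n\<^esub> f) = N +>\<^bsub>skew_ring p' m\<^esub> g)"
proof -
  let ?R = "skew_ring p n" and ?S = "skew_ring p' m"
  interpret M: ideal M ?R using assms by (simp add: graded_ideal_def)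
  interpret N: ideal N ?S using assms by (simp add: graded_ideal_def)
  let ?q = "\<lambda>f. M +>\<^bsub>?R\<^esub> f" and ?r = "\<lambda>g. N +>\<^bsub>?S\<^esub> g"
  have \<phi>: "\<phi> \<in> ring_iso (?R Quot M) (?S Quot N)" and \<phi>c: "\<phi> (?q (sk_const u)) = ?r (sk_const u)" for u
    using iso by (auto simp: alg_iso_quot_def)
  have q: "?q \<in> ring_hom ?R (?R Quot M)" by (rule M.rcos_ring_hom)
  have r: "?r \<in> ring_hom ?S (?S Quot N)" by (rule N.rcos_ring_hom)
  have qc: "?q f \<in> carrier (?R Quot M)" if "f \<in> sk_carrier n" for f
    using ring_hom_closed[OF q] that by (simp add: skew_ring_sel)
  have q_surj: "\<exists>f\<in>sk_carrier n. X = ?q f" if "X \<in> carrier (?R Quot M)" for X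
    using that by (auto simp: FactRing_def A_RCOSETS_def' skew_ring_sel(1))
  have r_surj: "\<exists>g\<in>sk_carrier m. Y = ?r g" if "Y \<in> carrier (?S Quot N)" for Y
    using that by (auto simp: FactRing_def A_RCOSETS_def' skew_ring_sel(1))
  have bij: "bij_betw \<phi> (carrier (?R Quot M)) (carrier (?S Quot N))"
    by (rule ring_iso_memE(5)[OF \<phi>])
  have q0: "?q f = ?q 0 \<longleftrightarrow> f \<in> M" if "f \<in> sk_carrier n" for f
  proof -
    have sub: "subgroup M (add_monoid ?R)" using M.additive_subgroup_axioms by (rule additive_subgroup.a_subgroup)
    have "?q 0 = M" using M.a_rcos_const[OF sk_ideal_zero[OF assms(3)]] .
    then show ?thesis
      using M.a_coset_join1[OF _ _ sub, of f] M.a_rcos_const[of f] that by (auto simp: skew_ring_sel)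
  qed
  have r0: "?r g = ?r 0 \<longleftrightarrow> g \<in> N" if "g \<in> sk_carrier m" for g
  proof -
    have sub: "subgroup N (add_monoid ?S)" using N.additive_subgroup_axioms by (rule additive_subgroup.a_subgroup)
    have "?r 0 = N" using N.a_rcos_const[OF sk_ideal_zero[OF assms(4)]] .
    then show ?thesis
      using N.a_coset_join1[OF _ _ sub, of g] N.a_rcos_const[of g] that by (auto simp: skew_ring_sel)
  qed
  have \<phi>0: "\<phi> (?q 0) = ?r 0" using \<phi>c[of 0] by (simp add: sk_const_0)
  show ?thesis
  \<comment> \<open>The cases follow the order of the locale assumptions: 7 is \<open>T_left\<close>
    and 15 is \<open>T_0_right\<close>; the first six are premises of the lemma.\<close>
  proof (unfold_locales, goal_cases)
    case (7 f g) then show ?case by simp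
  next
    case (8 f g) then show ?case by simp
  next
    case (9 f)
    then have "\<phi> (?q f) \<in> carrier (?S Quot N)" using bij qc by (blast dest: bij_betwE)
    then show ?case using r_surj 9 by blast
  next
    case (10 g)
    have "?r g \<in> \<phi> ` carrier (?R Quot M)"
      using bij ring_hom_closed[OF r] 10 by (simp add: bij_betw_def skew_ring_sel)
    then obtain X where "X \<in> carrier (?R Quot M)" "\<phi> X = ?r g" by auto
    then show ?case using q_surj 10 by metis
  next
    case (11 f g f' g')
    then show ?case
      using ring_hom_add[OF q, of f f'] ring_hom_add[OF r, of g g'] ring_iso_memE(3)[OF \<phi>, of "?q f" "?q f'"] qc
      by (simp add: skew_ring_sel sk_carrier_add)
  next
    case (12 f g f' g')
    then show ?case
      using ring_hom_mult[OF q, of f f'] ring_hom_mult[OF r, of g g'] ring_iso_memE(2)[OF \<phi>, of "?q f" "?q f'"] qc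
      by (simp add: skew_ring_sel sk_mult_closed)
  next
    case (13 u) then show ?case using \<phi>c by simp
  next
    case (14 g)
    then show ?case using \<phi>0 r0[of g] sk_ideal_carrier[OF assms(4), of g] by auto
  next
    case (15 f)
    \<comment> \<open>This direction, in contrast to case 14, relies on injectivity of
      \<open>\<phi>\<close>.\<close>
    have "\<phi> (?q f) = \<phi> (?q 0) \<longleftrightarrow> ?q f = ?q 0" if "f \<in> sk_carrier n"
      using bij qc[OF that] qc[of 0] by (auto simp: bij_betw_def inj_on_eq_iff)
    then show ?case using \<phi>0 q0[of f] sk_ideal_carrier[OF assms(3), of f] by auto
  qed (use assms in simp_all)
qed

theorem theorem0p4:
  fixes p :: "nat \<Rightarrow> nat \<Rightarrow> 'k::field" and p' :: "nat \<Rightarrow> nat \<Rightarrow> 'k"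
    and n m :: nat and M N :: "'k skpoly set"
  assumes "n \<ge> 1" and "m \<ge> 1"
    and "skew_params n p" and "skew_params m p'"
    and "\<forall>i<n. \<forall>j<n. i \<noteq> j \<longrightarrow> p i j \<noteq> 1"
    and "graded_ideal p n M" and "in_deg_ge n 3 M"
    and "graded_ideal p' m N" and "in_deg_ge m 2 N"
    and "\<exists>\<phi>. alg_iso_quot p n M p' m N \<phi>"
  shows "n = m \<and>
    (\<exists>\<sigma>. bij_betw \<sigma> {..<n} {..<n} \<and> (\<forall>i<n. \<forall>j<n. p' i j = p (\<sigma> i) (\<sigma> j)) \<and>
      (\<exists>c :: nat \<Rightarrow> 'k. (\<forall>i<n. c i \<noteq> 0) \<and>
         (let \<Phi> = sk_subst p n m (\<lambda>i. (\<lambda>a. c i * sk_var (\<sigma> i) a)) in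
            \<Phi> \<in> ring_iso (skew_ring p' m) (skew_ring p n) \<and> \<Phi> ` N = M)))"
proof -
  have M3: "M \<subseteq> sk_ge n 3" and N2: "N \<subseteq> sk_ge m 2"
    using assms(7,9) sk_ideal_carrier[OF assms(6)] sk_ideal_carrier[OF assms(8)]
    by (auto simp: in_deg_ge_def sk_ge_def)
  have M2: "M \<subseteq> sk_ge n 2" using M3 sk_ge_antimono[of _ n 3 2] by auto
  obtain \<phi> where \<phi>: "alg_iso_quot p n M p' m N \<phi>" using assms(10) by blast
  interpret skew_corr p n M p' m N "\<lambda>f g. f \<in> sk_carrier n \<and> g \<in> sk_carrier m \<and>
    \<phi> (M +>\<^bsub>skew_ring p n\<^esub> f) = N +>\<^bsub>skew_ring p' m\<^esub> g"
    by (rule skew_corr_of_iso[OF assms(3,4,6,8) M2 N2 \<phi>])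
  have not1: "p i j \<noteq> 1" if "i < n" "j < n" "i \<noteq> j" for i j using assms(5) that by blast
  have "\<exists>\<sigma> c. n = m \<and> monomial_subst p p' n \<sigma> c \<and>
      sk_subst p n n (\<lambda>i a. c i * sk_var (\<sigma> i) a) ` N = M"
  proof (cases is_local)
    case True
    obtain \<sigma> c F where nm: "n = m" and subst: "monomial_subst p p' n \<sigma> c"
      and F: "\<And>i. i < m \<Longrightarrow> F i \<in> sk_carrier n \<and> sk_var i \<in> (sk_carrier m :: 'k skpoly set) \<and>
        \<phi> (M +>\<^bsub>skew_ring p n\<^esub> F i) = N +>\<^bsub>skew_ring p' m\<^esub> sk_var i"
      and F_approx: "\<And>i. i < m \<Longrightarrow> F i - (\<lambda>a. c i * sk_var (\<sigma> i) a) \<in> sk_ge n 2"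
      by (rule local_case[OF True M3 not1]; (assumption | rule that))
    show ?thesis using nm subst local_image[OF True nm subst F F_approx] by blast
  next
    case False
    then have nm: "n = 1" "m = 1" "M = {0}" "N = {0}" using nonlocal[OF not1 assms(2)] by auto
    \<comment> \<open>Both sides are k[x] with zero ideal, so the identity with scalar 1 works; the
      only parameters are p_00 = p'_00 = 1.\<close>
    have subst: "monomial_subst p p' n id (\<lambda>_. 1)"
      using assms(3,4) nm by unfold_locales (auto simp: permutes_id skew_params_def)
    then interpret monomial_subst p p' n id "\<lambda>_. 1" .
    have "\<Phi> 0 = 0" using \<Phi>_const[of 0] by (simp only: sk_const_0)
    then have "\<Phi> ` N = M" using nm by simp
    moreover have "n = m" using nm by simp
    ultimately show ?thesis using subst by blast
  qed
  then obtain \<sigma> c where nm: "n = m" and subst: "monomial_subst p p' n \<sigma> c"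
    and image: "sk_subst p n n (\<lambda>i a. c i * sk_var (\<sigma> i) a) ` N = M" by blast
  interpret monomial_subst p p' n \<sigma> c by (rule subst)
  show ?thesis
    using nm permutes_imp_bij[OF perm] param_eq c_nonzero \<Phi>_ring_iso image
    unfolding Let_def by blast
qed

end
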